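(* Let $G$ be a sandpile graph with $n$ nonsink vertices, let $\mathcal{S}(G)$ be its sandpile group with character group $\mathcal{S}(G)^*=\mathrm{Hom}(\mathcal{S}(G),\mathbb{C}^\times)$, let $\rho:\mathcal{S}(G)^*\to\mathrm{GL}(\mathbb{C}^n)$, $\rho(\chi)=\mathrm{diag}(\chi(a_1),\dots,\chi(a_n))$, where $a_i\in\mathcal{S}(G)\cong\mathbb{Z}^n/\widetilde{\mathcal{L}}$ is the class of the configuration with exactly one grain of sand, at vertex $i$, and let $\mathcal{O}=\{(\chi(a_1),\dots,\chi(a_n)):\chi\in\mathcal{S}(G)^*\}\subset\mathbb{C}^n$ be the orbit of $(1,\dots,1)$ under $\rho$. 1. The representation $\rho$ is faithful, and the toppling ideal $I(G)$ is the set of polynomials in $\mathbb{C}[x_1,\dots,x_n]$ vanishing on $\mathcal{O}$. 2. The set of zeros of $I(G)$ in $\mathbb{C}^n$ is the finite set $\mathcal{O}$. It thus has the symmetry of $\mathcal{S}(G)^*$ (acting through $\rho$), which is isomorphic to $\mathcal{S}(G)$. 3. If $H_G$ is the affine Hilbert function for the toppling ideal, then $H_G(d)$ is the number of elements of $\mathbb{Z}^n/\widetilde{\mathcal{L}}$ represented by nonnegative configurations containing at most $d$ grains of sand. It is thus the number of superstable configurations of degree at most $d$ or, equivalently, the number of recurrent configurations $c$ such that $\deg(c)\ge\deg(c_{\max})-d$.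
   Context: A directed multigraph $G=(V,E)$ has a finite vertex set $V$ and edge set $E\subseteq V\times V$ with a weight function $\mathrm{wt}:V\times V\to\mathbb{N}$, $\mathrm{wt}(u,v)>0$ iff $(u,v)\in E$ (loops allowed); $\mathrm{outdeg}(v)=\sum_{u\in V}\mathrm{wt}(v,u)$. A sandpile graph $(V,E,s)$ is a directed multigraph with a vertex $s$ (the sink) that is globally accessible: from every vertex there is a directed path to $s$. Identify $\widetilde V=V\setminus\{s\}$ with $\{1,\dots,n\}$. The reduced Laplacian is $\widetilde\Delta:\mathbb{Z}\widetilde V\to\mathbb{Z}\widetilde V$, $\widetilde\Delta(v)=\mathrm{outdeg}(v)\,v-\sum_{u\in\widetilde V}\mathrm{wt}(v,u)\,u$; $\widetilde{\mathcal{L}}=\mathrm{im}(\widetilde\Delta)$, of finite index in $\mathbb{Z}^n$. The toppling ideal is $I(G)=\mathrm{Span}_{\mathbb{C}}\{x^u-x^v:u,v\in\mathbb{N}^n,\ u-v\in\widetilde{\mathcal{L}}\}\subseteq R=\mathbb{C}[x_1,\dots,x_n]$. Its affine Hilbert function is $H_G(d)=\dim_{\mathbb{C}}R_{\le d}/(I(G)\cap R_{\le d})$, where $R_{\le d}$ is the space of polynomials of degree at most $d$. A configuration is an element $c\in\mathbb{Z}\widetilde V$, with $\deg(c)=\sum_v c_v$ (the number of grains); it is stable if $c_v<\mathrm{outdeg}(v)$ for all $v\in\widetilde V$. Firing $v\in\widetilde V$ replaces $c$ by $c-\widetilde\Delta v$ and is legal if $c_v\ge\mathrm{outdeg}(v)$;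 $c\to\tilde c$ means $\tilde c$ is obtained by a finite (possibly empty) sequence of legal firings. $c$ is recurrent if it is nonnegative, stable, and for every configuration $a$ there is a nonnegative configuration $b$ with $a+b\to c$. The sandpile group $\mathcal{S}(G)$ is the group of recurrent configurations under addition followed by stabilization (firing unstable vertices until stable); it is identified with $\mathbb{Z}^n/\widetilde{\mathcal{L}}$ via $c\mapsto c+\widetilde{\mathcal{L}}$. $c_{\max}=\sum_{v\in\widetilde V}(\mathrm{outdeg}(v)-1)v$. $c$ is superstable if $c\ge 0$ and there is no nonzero $\sigma\in\mathbb{N}\widetilde V$ with $c-\widetilde\Delta\sigma\ge0$. *)

theory Defs
  imports
    "HOL-Algebra.Algebra"
    "Jordan_Normal_Form.VS_Connect"
begin

section \<open>Sandpile graphs\<close>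

record 'v multigraph =
  verts :: "'v set"
  edges :: "('v \<times> 'v) set"
  weight :: "'v \<Rightarrow> 'v \<Rightarrow> nat"

record 'v sandpile_graph = "'v multigraph" +
  sink :: 'v

definition is_multigraph :: "('v, 'b) multigraph_scheme \<Rightarrow> bool" where
  "is_multigraph G \<longleftrightarrow>
     finite (verts G) \<and> edges G \<subseteq> verts G \<times> verts G \<and>
     (\<forall>u\<in>verts G. \<forall>v\<in>verts G. weight G u v > 0 \<longleftrightarrow> (u, v) \<in> edges G)"

definition is_sandpile_graph :: "'v sandpile_graph \<Rightarrow> bool" where
  "is_sandpile_graph G \<longleftrightarrow>
     is_multigraph G \<and> sink G \<in> verts G \<and> (\<forall>v\<in>verts G. (v, sink G) \<in> (edges G)\<^sup>*)"

definition outdeg :: "'v sandpile_graph \<Rightarrow> 'v \<Rightarrow> nat" where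
  "outdeg G v = (\<Sum>u\<in>verts G. weight G v u)"

definition nonsink :: "'v sandpile_graph \<Rightarrow> 'v set" where
  "nonsink G = verts G - {sink G}"

section \<open>Configurations and the reduced Laplacian\<close>

text \<open>The group of configurations is the free abelian group on the nonsink vertices: its elements
  are the finitely supported functions \<^typ>\<open>'v \<Rightarrow>\<^sub>0 int\<close> whose support consists of nonsink vertices.\<close>

abbreviation config_group :: "'v sandpile_graph \<Rightarrow> ('v \<Rightarrow>\<^sub>0 int) monoid" where
  "config_group G \<equiv> free_Abelian_group (nonsink G)"

definition reduced_laplacian :: "'v sandpile_graph \<Rightarrow> ('v \<Rightarrow>\<^sub>0 int) \<Rightarrow> ('v \<Rightarrow>\<^sub>0 int)" where
  "reduced_laplacian G = frag_extend (\<lambda>v.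
     frag_cmul (int (outdeg G v)) (frag_of v)
     - (\<Sum>u\<in>nonsink G. frag_cmul (int (weight G v u)) (frag_of u)))"

definition laplacian_lattice :: "'v sandpile_graph \<Rightarrow> ('v \<Rightarrow>\<^sub>0 int) set" where
  "laplacian_lattice G = reduced_laplacian G ` carrier (config_group G)"

definition config_deg :: "'v sandpile_graph \<Rightarrow> ('v \<Rightarrow>\<^sub>0 int) \<Rightarrow> int" where
  "config_deg G c = (\<Sum>v\<in>nonsink G. Poly_Mapping.lookup c v)"

definition nonneg_config :: "'v sandpile_graph \<Rightarrow> ('v \<Rightarrow>\<^sub>0 int) \<Rightarrow> bool" where
  "nonneg_config G c \<longleftrightarrow>
     c \<in> carrier (config_group G) \<and> (\<forall>v\<in>nonsink G. Poly_Mapping.lookup c v \<ge> 0)"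

definition stable_config :: "'v sandpile_graph \<Rightarrow> ('v \<Rightarrow>\<^sub>0 int) \<Rightarrow> bool" where
  "stable_config G c \<longleftrightarrow>
     c \<in> carrier (config_group G) \<and> (\<forall>v\<in>nonsink G. Poly_Mapping.lookup c v < int (outdeg G v))"

definition legal_firing :: "'v sandpile_graph \<Rightarrow> ('v \<Rightarrow>\<^sub>0 int) \<Rightarrow> ('v \<Rightarrow>\<^sub>0 int) \<Rightarrow> bool" where
  "legal_firing G c c' \<longleftrightarrow>
     (\<exists>v\<in>nonsink G. Poly_Mapping.lookup c v \<ge> int (outdeg G v)
       \<and> c' = c - reduced_laplacian G (frag_of v))"

definition topples_to :: "'v sandpile_graph \<Rightarrow> ('v \<Rightarrow>\<^sub>0 int) \<Rightarrow> ('v \<Rightarrow>\<^sub>0 int) \<Rightarrow> bool" where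
  "topples_to G = (legal_firing G)\<^sup>*\<^sup>*"

definition recurrent_configs :: "'v sandpile_graph \<Rightarrow> ('v \<Rightarrow>\<^sub>0 int) set" where
  "recurrent_configs G = {c. nonneg_config G c \<and> stable_config G c \<and>
     (\<forall>a\<in>carrier (config_group G). \<exists>b. nonneg_config G b \<and> topples_to G (a + b) c)}"

definition superstable_configs :: "'v sandpile_graph \<Rightarrow> ('v \<Rightarrow>\<^sub>0 int) set" where
  "superstable_configs G = {c. nonneg_config G c \<and>
     \<not> (\<exists>\<sigma>. nonneg_config G \<sigma> \<and> \<sigma> \<noteq> 0 \<and> nonneg_config G (c - reduced_laplacian G \<sigma>))}"

definition max_stable_config :: "'v sandpile_graph \<Rightarrow> ('v \<Rightarrow>\<^sub>0 int)" where
  "max_stable_config G = (\<Sum>v\<in>nonsink G. frag_cmul (int (outdeg G v) - 1) (frag_of v))"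

section \<open>The sandpile group, its characters and their orbit\<close>

definition stabilization :: "'v sandpile_graph \<Rightarrow> ('v \<Rightarrow>\<^sub>0 int) \<Rightarrow> ('v \<Rightarrow>\<^sub>0 int)" where
  "stabilization G c = (THE c'. topples_to G c c' \<and> stable_config G c')"

text \<open>The neutral element is in general not the zero configuration, which need not be recurrent.\<close>

definition sandpile_group :: "'v sandpile_graph \<Rightarrow> ('v \<Rightarrow>\<^sub>0 int) monoid" where
  "sandpile_group G =
     \<lparr>carrier = recurrent_configs G,
      monoid.mult = (\<lambda>a b. stabilization G (a + b)),
      one = (THE e. e \<in> recurrent_configs G \<and>
               (\<forall>c\<in>recurrent_configs G. stabilization G (e + c) = c))\<rparr>"

definition config_class_group :: "'v sandpile_graph \<Rightarrow> ('v \<Rightarrow>\<^sub>0 int) set monoid" where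
  "config_class_group G = config_group G Mod laplacian_lattice G"

text \<open>The identification of the sandpile group with the group of classes of configurations.\<close>

definition config_class :: "'v sandpile_graph \<Rightarrow> ('v \<Rightarrow>\<^sub>0 int) \<Rightarrow> ('v \<Rightarrow>\<^sub>0 int) set" where
  "config_class G c = laplacian_lattice G #>\<^bsub>config_group G\<^esub> c"

definition grain_elem :: "'v sandpile_graph \<Rightarrow> 'v \<Rightarrow> ('v \<Rightarrow>\<^sub>0 int)" where
  "grain_elem G v = the_inv_into (recurrent_configs G) (config_class G) (config_class G (frag_of v))"

definition complex_units :: "complex monoid" where
  "complex_units = \<lparr>carrier = UNIV - {0}, monoid.mult = (*), one = 1\<rparr>"

text \<open>Homomorphisms are made extensional, so that two characters that agree on the group are equal.\<close>

definition character_group :: "('a, 'b) monoid_scheme \<Rightarrow> ('a \<Rightarrow> complex) monoid" where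
  "character_group A =
     \<lparr>carrier = hom A complex_units \<inter> extensional (carrier A),
      monoid.mult = (\<lambda>\<chi> \<psi>. restrict (\<lambda>a. \<chi> a * \<psi> a) (carrier A)),
      one = restrict (\<lambda>a. 1) (carrier A)\<rparr>"

definition complex_GL :: "nat \<Rightarrow> complex mat monoid" where
  "complex_GL n = units_of (ring_mat TYPE(complex) n ())"

text \<open>Below, \<open>\<nu>\<close> is the chosen numbering of the \<open>n\<close> nonsink vertices. Coordinates of vectors are
  counted from \<open>0\<close>, so \<open>\<nu> i\<close> is the nonsink vertex number \<open>i + 1\<close>.\<close>

definition sandpile_rep ::
    "'v sandpile_graph \<Rightarrow> nat \<Rightarrow> (nat \<Rightarrow> 'v) \<Rightarrow> (('v \<Rightarrow>\<^sub>0 int) \<Rightarrow> complex) \<Rightarrow> complex mat" where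
  "sandpile_rep G n \<nu> \<chi> = mat_diag n (\<lambda>i. \<chi> (grain_elem G (\<nu> i)))"

definition sandpile_orbit :: "'v sandpile_graph \<Rightarrow> nat \<Rightarrow> (nat \<Rightarrow> 'v) \<Rightarrow> complex vec set" where
  "sandpile_orbit G n \<nu> =
     (\<lambda>\<chi>. vec n (\<lambda>i. \<chi> (grain_elem G (\<nu> i)))) ` carrier (character_group (sandpile_group G))"

lemma sandpile_orbit_eq_orbit:
  "sandpile_orbit G n \<nu> =
     (\<lambda>\<chi>. sandpile_rep G n \<nu> \<chi> *\<^sub>v vec n (\<lambda>i. 1)) ` carrier (character_group (sandpile_group G))"
proof -
  have "sandpile_rep G n \<nu> \<chi> *\<^sub>v vec n (\<lambda>i. 1) = vec n (\<lambda>i. \<chi> (grain_elem G (\<nu> i)))" for \<chi>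
    by (rule eq_vecI) (auto simp: sandpile_rep_def mat_diag_def scalar_prod_def)
  then show ?thesis
    by (simp add: sandpile_orbit_def)
qed

section \<open>Polynomials and the toppling ideal\<close>

text \<open>The type \<^typ>\<open>'v \<Rightarrow>\<^sub>0 nat\<close> is that of exponents, with one variable for each \<^typ>\<open>'v\<close>;
  the ring operations on \<^typ>\<open>('v \<Rightarrow>\<^sub>0 nat) \<Rightarrow>\<^sub>0 complex\<close> are those of the monoid algebra.\<close>

type_synonym 'v cpoly = "('v \<Rightarrow>\<^sub>0 nat) \<Rightarrow>\<^sub>0 complex"

definition exponents :: "'v sandpile_graph \<Rightarrow> ('v \<Rightarrow>\<^sub>0 nat) set" where
  "exponents G = {m. Poly_Mapping.keys m \<subseteq> nonsink G}"

definition exponent_deg :: "('v \<Rightarrow>\<^sub>0 nat) \<Rightarrow> nat" where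
  "exponent_deg m = (\<Sum>v\<in>Poly_Mapping.keys m. Poly_Mapping.lookup m v)"

definition nonsink_polys :: "'v sandpile_graph \<Rightarrow> 'v cpoly set" where
  "nonsink_polys G = {p. Poly_Mapping.keys p \<subseteq> exponents G}"

definition polys_le :: "'v sandpile_graph \<Rightarrow> nat \<Rightarrow> 'v cpoly set" where
  "polys_le G d = {p \<in> nonsink_polys G. \<forall>m\<in>Poly_Mapping.keys p. exponent_deg m \<le> d}"

definition poly_scale :: "complex \<Rightarrow> 'v cpoly \<Rightarrow> 'v cpoly" where
  "poly_scale a p = Poly_Mapping.map ((*) a) p"

lemma lookup_poly_scale [simp]: "Poly_Mapping.lookup (poly_scale a p) m = a * Poly_Mapping.lookup p m"
  by (simp add: poly_scale_def map.rep_eq when_def)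

interpretation cpoly: vector_space "poly_scale :: complex \<Rightarrow> 'v cpoly \<Rightarrow> 'v cpoly"
  by unfold_locales (auto intro!: poly_mapping_eqI simp: Poly_Mapping.lookup_add algebra_simps)

definition toppling_ideal :: "'v sandpile_graph \<Rightarrow> 'v cpoly set" where
  "toppling_ideal G = cpoly.span
     {Poly_Mapping.single u 1 - Poly_Mapping.single w 1 | u w.
        u \<in> exponents G \<and> w \<in> exponents G \<and>
        Poly_Mapping.map int u - Poly_Mapping.map int w \<in> laplacian_lattice G}"

definition eval_at :: "nat \<Rightarrow> (nat \<Rightarrow> 'v) \<Rightarrow> complex vec \<Rightarrow> 'v cpoly \<Rightarrow> complex" where
  "eval_at n \<nu> z p =
     (\<Sum>m\<in>Poly_Mapping.keys p. Poly_Mapping.lookup p m * (\<Prod>i<n. (z $ i) ^ Poly_Mapping.lookup m (\<nu> i)))"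

definition zero_locus :: "nat \<Rightarrow> (nat \<Rightarrow> 'v) \<Rightarrow> 'v cpoly set \<Rightarrow> complex vec set" where
  "zero_locus n \<nu> I = {z \<in> carrier_vec n. \<forall>p\<in>I. eval_at n \<nu> z p = 0}"

definition vanishing_polys ::
    "'v sandpile_graph \<Rightarrow> nat \<Rightarrow> (nat \<Rightarrow> 'v) \<Rightarrow> complex vec set \<Rightarrow> 'v cpoly set" where
  "vanishing_polys G n \<nu> Z = {p \<in> nonsink_polys G. \<forall>z\<in>Z. eval_at n \<nu> z p = 0}"

section \<open>The affine Hilbert function\<close>

text \<open>In both records the ring fields \<open>mult\<close> and \<open>one\<close> play no role and are left unspecified, as in
  \<^const>\<open>module_vec\<close>.\<close>

definition polys_le_space :: "'v sandpile_graph \<Rightarrow> nat \<Rightarrow> (complex, 'v cpoly) module" where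
  "polys_le_space G d =
     \<lparr>carrier = polys_le G d, monoid.mult = undefined, one = undefined,
      ring.zero = 0, add = (+), smult = poly_scale\<rparr>"

text \<open>Adding \<open>W\<close> in the scalar multiplication matters for the scalar \<open>0\<close> only, where the elementwise
  multiple of a coset would be \<open>{0}\<close> instead of \<open>W\<close>.\<close>

definition quotient_space :: "('a, 'b, 'c) module_scheme \<Rightarrow> 'b set \<Rightarrow> ('a, 'b set) module" where
  "quotient_space M W =
     \<lparr>carrier = a_rcosets\<^bsub>M\<^esub> W, monoid.mult = undefined, one = undefined,
      ring.zero = W, add = (\<lambda>A B. A <+>\<^bsub>M\<^esub> B), smult = (\<lambda>a A. W <+>\<^bsub>M\<^esub> (\<lambda>x. a \<odot>\<^bsub>M\<^esub> x) ` A)\<rparr>"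

definition affine_hilbert :: "'v sandpile_graph \<Rightarrow> nat \<Rightarrow> nat" where
  "affine_hilbert G d =
     vectorspace.dim class_ring
       (quotient_space (polys_le_space G d) (toppling_ideal G \<inter> polys_le G d))"

end

theory Submission
  imports Defs
begin

text \<open>Monomials in the nonsink variables are nonnegative configurations, so every monomial has a class
  in the sandpile group \<open>S\<close>. At the point of \<open>\<O>\<close> that belongs to a character \<open>\<chi>\<close>, the monomial takes
  the value of \<open>\<chi>\<close> at this class. Hence the value of a polynomial \<open>p\<close> there is the sum of
  \<open>class_sum a p * \<chi> a\<close> over \<open>a \<in> S\<close>, where \<open>class_sum a p\<close> is the sum of the coefficients of \<open>p\<close> in the
  class \<open>a\<close>: evaluation on the orbit is the Fourier transform of the class sums. This is the idea
  that carries everything.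

  The Fourier transform of a finite abelian group is injective (\<open>fourier_injective\<close>), so \<open>p\<close> vanishes
  on \<open>\<O>\<close> if and only if its class sums are zero; and the polynomials with zero class sums are exactly the
  combinations of binomials in the toppling ideal (\<open>toppling_ideal_eq\<close>). Conversely, a common zero of
  the binomials gives equal values to monomials of the same class, so these values define a character
  of \<open>S\<close> and the zero lies on \<open>\<O>\<close> (\<open>zero_locus_toppling_ideal\<close>).

  On the polynomials of degree at most \<open>d\<close> only the classes that contain such a monomial have class
  sums that can be nonzero. For these classes the class sums are linear functionals with common kernel
  the ideal, and one monomial from each class is a dual system, so the Hilbert function counts these
  classes (\<open>affine_hilbert_eq_card_classes\<close>). A superstable configuration is obtained from any
  nonnegative one by firings that never increase the degree, and each class has only one; so the same
  number counts superstable configurations. Finally \<open>c \<mapsto> c_max - c\<close> exchanges superstable and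
  recurrent configurations (\<open>recurrent_iff_superstable\<close>).

  Two foundations are needed. That a finite abelian group is isomorphic to its character group, and
  that its characters suffice for Fourier inversion, both follow from a symmetric nondegenerate pairing
  with values in the complex units, constructed by splitting off cyclic factors
  (\<open>ex_symmetric_pairing\<close>). That stabilization ends, that superstable representatives exist and that
  the group is finite all rest on an integral linear function of configurations that every firing
  decreases (\<open>height_superharmonic\<close>), which exists because the sink is globally accessible.\<close>

section \<open>Characters of finite abelian groups\<close>

lemma hom_complex_units_iff:
  "\<chi> \<in> hom A complex_units \<longleftrightarrow>
     (\<forall>x\<in>carrier A. \<chi> x \<noteq> 0) \<and> (\<forall>x\<in>carrier A. \<forall>y\<in>carrier A. \<chi> (x \<otimes>\<^bsub>A\<^esub> y) = \<chi> x * \<chi> y)"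
  by (auto simp: hom_def complex_units_def Pi_iff)

context group
begin

lemma char_nonzero: "\<chi> \<in> hom G complex_units \<Longrightarrow> x \<in> carrier G \<Longrightarrow> \<chi> x \<noteq> 0"
  by (simp add: hom_complex_units_iff)

lemma char_mult:
  "\<chi> \<in> hom G complex_units \<Longrightarrow> x \<in> carrier G \<Longrightarrow> y \<in> carrier G \<Longrightarrow> \<chi> (x \<otimes> y) = \<chi> x * \<chi> y"
  by (simp add: hom_complex_units_iff)

lemma char_one: "\<chi> \<in> hom G complex_units \<Longrightarrow> \<chi> \<one> = 1"
  using char_mult[of \<chi> \<one> \<one>] char_nonzero[of \<chi> \<one>] by simp

lemma char_inv: "\<chi> \<in> hom G complex_units \<Longrightarrow> x \<in> carrier G \<Longrightarrow> \<chi> (inv x) = inverse (\<chi> x)"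
  using char_mult[of \<chi> x "inv x"] char_one[of \<chi>] char_nonzero[of \<chi> x]
  by (simp add: divide_simps mult.commute inverse_eq_divide)

lemma char_pow: "\<chi> \<in> hom G complex_units \<Longrightarrow> x \<in> carrier G \<Longrightarrow> \<chi> (x [^] (n::nat)) = \<chi> x ^ n"
  by (induction n) (simp_all add: char_one char_mult mult.commute)

end

lemma character_group_mult:
  assumes "\<chi> \<in> carrier (character_group A)" "\<psi> \<in> carrier (character_group A)"  "group A"
  shows "\<chi> \<otimes>\<^bsub>character_group A\<^esub> \<psi> \<in> carrier (character_group A)"
    and "a \<in> carrier A \<Longrightarrow> (\<chi> \<otimes>\<^bsub>character_group A\<^esub> \<psi>) a = \<chi> a * \<psi> a"
  using assms group.is_monoid[OF assms(3)]
  by (auto simp: character_group_def hom_complex_units_iff monoid.m_closed)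

text \<open>Let \<open>x\<^sup>m\<close> be the least positive power of \<open>x\<close> in \<open>H\<close>. The value of the extension at \<open>x\<close> may be any \<open>z\<close> with
  \<open>z ^ m = \<chi> (x\<^sup>m)\<close>: two representations \<open>h x\<^sup>i = h' x\<^sup>j\<close> of an element differ by a power of \<open>x\<^sup>m\<close>, and the
  value \<open>\<chi> h * z ^ i\<close> does not change under that.\<close>

lemma character_extension_step:
  fixes G (structure)
  assumes "comm_group G" "finite (carrier G)" "subgroup H G"
    and chi: "\<chi> \<in> hom (G\<lparr>carrier := H\<rparr>) complex_units" and x: "x \<in> carrier G"
  obtains K \<psi> where "subgroup K G" "H \<subseteq> K" "x \<in> K" "\<psi> \<in> hom (G\<lparr>carrier := K\<rparr>) complex_units"
    "\<And>h. h \<in> H \<Longrightarrow> \<psi> h = \<chi> h"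
proof -
  interpret comm_group G by fact
  interpret H: subgroup H G by fact
  interpret GH: group "G\<lparr>carrier := H\<rparr>" using assms(3) by (rule subgroup_imp_group)
  have ordx: "ord x > 0" using ord_ge_1[OF assms(2) x] by simp
  define m where "m = (LEAST m::nat. m > 0 \<and> x [^] m \<in> H)"
  have "m > 0 \<and> x [^] m \<in> H"
    unfolding m_def by (rule LeastI[of _ "ord x"]) (use ordx x in simp)
  then have m: "m > 0" "x [^] m \<in> H" by auto
  have m_dvd: "m dvd k" if "x [^] k \<in> H" for k :: nat
  proof (rule ccontr)
    assume "\<not> m dvd k"
    then have "k mod m > 0" by (simp add: mod_greater_zero_iff_not_dvd)
    have "x [^] k = x [^] (m * (k div m)) \<otimes> x [^] (k mod m)"
      using x by (simp add: nat_pow_mult)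
    also have "x [^] (m * (k div m)) = (x [^] m) [^] (k div m)" using x by (simp add: nat_pow_pow)
    finally have "x [^] (k mod m) = inv ((x [^] m) [^] (k div m)) \<otimes> x [^] k"
      using x by (simp add: inv_solve_left)
    moreover have "(x [^] m) [^] (k div m) \<in> H"
      using m(2) GH.nat_pow_closed[of "x [^] m" "k div m"] nat_pow_consistent by auto
    ultimately have "x [^] (k mod m) \<in> H" using that by simp
    with \<open>k mod m > 0\<close> have "m \<le> k mod m" unfolding m_def by (intro Least_le) auto
    then show False using m(1) mod_less_divisor[of m k] by linarith
  qed
  have nz: "\<chi> h \<noteq> 0" if "h \<in> H" for h using chi that by (simp add: hom_complex_units_iff)
  have mult: "\<chi> (h \<otimes> k) = \<chi> h * \<chi> k" if "h \<in> H" "k \<in> H" for h k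
    using chi that by (simp add: hom_complex_units_iff)
  have pow: "\<chi> (h [^] (k::nat)) = \<chi> h ^ k" if "h \<in> H" for h k
    using GH.char_pow[OF chi, of h k] that nat_pow_consistent[of h k H] by simp
  have "card {z. z ^ m = \<chi> (x [^] m)} = m" using m nz by (intro card_nth_roots) auto
  then have "{z. z ^ m = \<chi> (x [^] m)} \<noteq> {}" using m(1) by (metis card.empty less_numeral_extra(3))
  then obtain z where z: "z ^ m = \<chi> (x [^] m)" by auto
  have z0: "z \<noteq> 0" using z m nz by (metis power_0_left power_eq_0_iff)
  have wd_le: "\<chi> h * z ^ i = \<chi> h' * z ^ j"
    if eq: "h \<otimes> x [^] i = h' \<otimes> x [^] j" and "h \<in> H" "h' \<in> H" "i \<le> j" for h h' and i j :: nat
  proof -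
    have hc: "h \<in> carrier G" "h' \<in> carrier G" using that by auto
    have "h' \<otimes> x [^] j = (h' \<otimes> x [^] (j - i)) \<otimes> x [^] i"
      using hc x \<open>i \<le> j\<close> by (simp add: m_assoc nat_pow_mult)
    then have h: "h = h' \<otimes> x [^] (j - i)" using eq hc x by (metis m_closed nat_pow_closed r_cancel)
    then have "x [^] (j - i) = inv h' \<otimes> h" using hc x by (simp add: inv_solve_left)
    then have "x [^] (j - i) \<in> H" using that by simp
    then obtain q where q: "j - i = m * q" using m_dvd by blast
    have "\<chi> (x [^] (j - i)) = z ^ (j - i)"
      using pow[OF m(2), of q] x by (simp add: q nat_pow_pow power_mult z)
    then have "\<chi> h = \<chi> h' * z ^ (j - i)"
      using h mult[OF \<open>h' \<in> H\<close> \<open>x [^] (j - i) \<in> H\<close>] by simp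
    then show ?thesis using \<open>i \<le> j\<close> by (simp add: power_add[symmetric])
  qed
  have wd: "\<chi> h * z ^ i = \<chi> h' * z ^ j"
    if eq: "h \<otimes> x [^] i = h' \<otimes> x [^] j" and "h \<in> H" "h' \<in> H" for h h' and i j :: nat
    using wd_le[OF eq] wd_le[OF eq[symmetric]] that by (metis nat_le_linear)
  define K where "K = {h \<otimes> x [^] (k::nat) |h k. h \<in> H}"
  define \<psi> where "\<psi> y = (SOME c. \<exists>h\<in>H. \<exists>k::nat. y = h \<otimes> x [^] k \<and> c = \<chi> h * z ^ k)" for y
  have psi: "\<psi> (h \<otimes> x [^] k) = \<chi> h * z ^ k" if "h \<in> H" for h and k :: nat
    unfolding \<psi>_def
  proof (rule some_equality)
    show "\<exists>h'\<in>H. \<exists>k'::nat. h \<otimes> x [^] k = h' \<otimes> x [^] k' \<and> \<chi> h * z ^ k = \<chi> h' * z ^ k'"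
      using that by blast
    fix c assume "\<exists>h'\<in>H. \<exists>k'::nat. h \<otimes> x [^] k = h' \<otimes> x [^] k' \<and> c = \<chi> h' * z ^ k'"
    then show "c = \<chi> h * z ^ k" using wd[OF _ that] by auto
  qed
  have mulK: "(h \<otimes> x [^] i) \<otimes> (h' \<otimes> x [^] j) = (h \<otimes> h') \<otimes> x [^] (i + j)" if "h \<in> H" "h' \<in> H" for h h' and i j :: nat
  proof -
    have "(h \<otimes> x [^] i) \<otimes> (h' \<otimes> x [^] j) = (h \<otimes> h') \<otimes> (x [^] i \<otimes> x [^] j)"
      using that x by (simp add: m_ac)
    then show ?thesis using x by (simp add: nat_pow_mult)
  qed
  have subK: "subgroup K G"
  proof (rule subgroupI)
    show "K \<subseteq> carrier G" unfolding K_def using x by auto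
    show "K \<noteq> {}" unfolding K_def using H.one_closed by blast
  next
    fix a assume "a \<in> K"
    then obtain h and k :: nat where a: "a = h \<otimes> x [^] k" "h \<in> H" unfolding K_def by auto
    have "x [^] k \<otimes> x [^] (ord x * k - k) = x [^] (ord x * k)"
      using x ordx by (simp add: nat_pow_mult)
    also have "\<dots> = \<one>" using x by (simp add: pow_eq_id)
    finally have "inv (x [^] k) = x [^] (ord x * k - k)" using x by (intro inv_equality) (simp_all add: m_comm)
    then have "inv a = inv h \<otimes> x [^] (ord x * k - k)" using a x by (simp add: inv_mult)
    then show "inv a \<in> K" unfolding K_def using a(2) by blast
  next
    fix a b assume "a \<in> K" "b \<in> K"
    then obtain h h' and i j :: nat where "a = h \<otimes> x [^] i" "h \<in> H" "b = h' \<otimes> x [^] j" "h' \<in> H"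
      unfolding K_def by auto
    then have "a \<otimes> b = (h \<otimes> h') \<otimes> x [^] (i + j)" "h \<otimes> h' \<in> H" using mulK by auto
    then show "a \<otimes> b \<in> K" unfolding K_def by blast
  qed
  have HK: "h = h \<otimes> x [^] (0::nat)" if "h \<in> H" for h using that x by simp
  show ?thesis
  proof (rule that[OF subK])
    show "H \<subseteq> K" unfolding K_def using HK by blast
    have "x = \<one> \<otimes> x [^] (1::nat)" using x by simp
    then show "x \<in> K" unfolding K_def using H.one_closed by blast
    show "\<psi> h = \<chi> h" if "h \<in> H" for h using psi[OF that, of 0] HK[OF that] by simp
    show "\<psi> \<in> hom (G\<lparr>carrier := K\<rparr>) complex_units"
      unfolding hom_complex_units_iff
    proof (intro conjI ballI)
      fix a assume "a \<in> carrier (G\<lparr>carrier := K\<rparr>)"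
      then obtain h and k :: nat where a: "a = h \<otimes> x [^] k" "h \<in> H" unfolding K_def by auto
      show "\<psi> a \<noteq> 0" using a psi nz z0 by simp
      fix b assume "b \<in> carrier (G\<lparr>carrier := K\<rparr>)"
      then obtain h' and k' :: nat where b: "b = h' \<otimes> x [^] k'" "h' \<in> H" unfolding K_def by auto
      show "\<psi> (a \<otimes>\<^bsub>G\<lparr>carrier := K\<rparr>\<^esub> b) = \<psi> a * \<psi> b"
        using a b by (simp add: mulK psi mult power_add)
    qed
  qed
qed

lemma character_extension:
  fixes G (structure)
  assumes G: "comm_group G" "finite (carrier G)" and "subgroup H G"
    and "\<chi> \<in> hom (G\<lparr>carrier := H\<rparr>) complex_units"
  obtains \<psi> where "\<psi> \<in> hom G complex_units" "\<And>h. h \<in> H \<Longrightarrow> \<psi> h = \<chi> h"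
proof -
  have "\<exists>\<psi>\<in>hom G complex_units. \<forall>h\<in>H. \<psi> h = \<chi> h"
    using assms(3,4)
  proof (induction "card (carrier G - H)" arbitrary: H \<chi> rule: less_induct)
    case less
    show ?case
    proof (cases "H = carrier G")
      case True
      then show ?thesis using less.prems by auto
    next
      case False
      then obtain x where x: "x \<in> carrier G" "x \<notin> H" using subgroup.subset[OF less.prems(1)] by auto
      obtain K \<phi> where K: "subgroup K G" "H \<subseteq> K" "x \<in> K" "\<phi> \<in> hom (G\<lparr>carrier := K\<rparr>) complex_units"
        "\<And>h. h \<in> H \<Longrightarrow> \<phi> h = \<chi> h"
        using character_extension_step[OF G less.prems x(1)] by blast
      have "carrier G - K \<subset> carrier G - H" using K x by auto
      then have "card (carrier G - K) < card (carrier G - H)" using G by (intro psubset_card_mono) auto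
      from less.hyps[OF this K(1) K(4)] obtain \<psi> where
        "\<psi> \<in> hom G complex_units" "\<forall>h\<in>K. \<psi> h = \<phi> h" by blast
      then show ?thesis using K(2,5) by (metis subsetD)
    qed
  qed
  then show ?thesis using that by blast
qed

lemma cis_root_pow_eq_1_iff:
  assumes "n > 0"
  shows "cis (2 * pi / real n) ^ k = 1 \<longleftrightarrow> n dvd k"
proof
  assume "cis (2 * pi / real n) ^ k = 1"
  then have "cos (real k * (2 * pi / real n)) = 1" by (simp add: DeMoivre complex_eq_iff)
  then obtain m :: int where m: "real k * (2 * pi / real n) = real_of_int m * 2 * pi"
    unfolding cos_one_2pi_int by auto
  have "real k = real_of_int m * real n" using m assms by (simp add: field_simps)
  then have "real_of_int (int k) = real_of_int (m * int n)" by simp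
  then have "int k = m * int n" by (simp only: of_int_eq_iff)
  then show "n dvd k" using int_dvd_int_iff by (metis dvd_triv_right)
next
  assume "n dvd k"
  then obtain m where "k = n * m" by auto
  then have "cis (2 * pi / real n) ^ k = cis (2 * pi) ^ m"
    using assms by (simp add: power_mult DeMoivre)
  then show "cis (2 * pi / real n) ^ k = 1" by simp
qed

text \<open>Translation by \<open>x\<close> permutes the summands and multiplies the sum by \<open>\<chi> x\<close>.\<close>

lemma sum_character_eq_0:
  fixes G (structure)
  assumes "group G" and chi: "\<chi> \<in> hom G complex_units"
    and x: "x \<in> carrier G" "\<chi> x \<noteq> 1"
  shows "(\<Sum>y\<in>carrier G. \<chi> y) = 0"
proof -
  interpret group G by fact
  have "bij_betw (\<lambda>y. x \<otimes> y) (carrier G) (carrier G)"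
    by (rule bij_betwI[where g = "\<lambda>y. inv x \<otimes> y"]) (use x in \<open>auto simp: m_assoc[symmetric]\<close>)
  then have "(\<Sum>y\<in>carrier G. \<chi> y) = (\<Sum>y\<in>carrier G. \<chi> (x \<otimes> y))"
    by (rule sum.reindex_bij_betw[symmetric])
  also have "\<dots> = \<chi> x * (\<Sum>y\<in>carrier G. \<chi> y)"
    using x by (simp add: sum_distrib_left char_mult[OF chi])
  finally show ?thesis using x(2) by simp
qed

text \<open>Multiplication by one value permutes the finite set of values. Comparing the products of all values
  shows that each value is a root of unity of order dividing the number of values, and there are no
  more such roots than values.\<close>

lemma character_image:
  fixes G (structure)
  assumes "group G" "finite (carrier G)" and chi: "\<chi> \<in> hom G complex_units"
  shows "\<chi> ` carrier G = {z. z ^ card (\<chi> ` carrier G) = 1}"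
proof -
  interpret group G by fact
  let ?I = "\<chi> ` carrier G"
  have fin: "finite ?I" using assms(2) by simp
  have pos: "card ?I > 0" using fin by (simp add: card_gt_0_iff) blast
  have "z ^ card ?I = 1" if z: "z \<in> ?I" for z
  proof -
    obtain x where x: "x \<in> carrier G" "z = \<chi> x" using z by auto
    have "inj_on ((*) z) ?I" using x char_nonzero[OF chi] by (auto simp: inj_on_def)
    moreover have "(*) z ` ?I \<subseteq> ?I"
      using x by (auto simp: char_mult[OF chi, symmetric])
    ultimately have "(*) z ` ?I = ?I" using fin by (intro endo_inj_surj)
    then have "(\<Prod>w\<in>?I. w) = (\<Prod>w\<in>?I. z * w)"
      using \<open>inj_on ((*) z) ?I\<close> by (metis (mono_tags, lifting) prod.reindex_cong)
    also have "\<dots> = z ^ card ?I * (\<Prod>w\<in>?I. w)" by (simp add: prod.distrib)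
    finally show ?thesis using char_nonzero[OF chi] fin by (auto simp: prod_zero_iff)
  qed
  then have "?I \<subseteq> {z. z ^ card ?I = 1}" by blast
  then show ?thesis
    using pos by (intro card_subset_eq) (auto simp: card_roots_unity_eq finite_roots_unity)
qed

text \<open>Nondegeneracy on the left suffices, because the pairing is symmetric.\<close>

definition symmetric_pairing :: "('a, 'b) monoid_scheme \<Rightarrow> ('a \<Rightarrow> 'a \<Rightarrow> complex) \<Rightarrow> bool" where
  "symmetric_pairing G B \<longleftrightarrow>
     (\<forall>x\<in>carrier G. B x \<in> hom G complex_units)
     \<and> (\<forall>x\<in>carrier G. \<forall>y\<in>carrier G. B x y = B y x)
     \<and> (\<forall>x\<in>carrier G. (\<forall>y\<in>carrier G. B x y = 1) \<longrightarrow> x = \<one>\<^bsub>G\<^esub>)"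

text \<open>The character is an extension of a faithful character of the cyclic group generated by an element
  \<open>g\<close> of maximal order \<open>N\<close>. Its values form the group of roots of unity of some order \<open>M\<close>, and a
  preimage of a primitive one has order at least \<open>M\<close>; maximality of \<open>N\<close> gives \<open>M = N\<close>. So \<open>\<chi>\<close> takes its
  values already on the powers of \<open>g\<close>, and its kernel is a complement of the cyclic group.\<close>

lemma ex_splitting_character:
  fixes G (structure)
  assumes G: "comm_group G" "finite (carrier G)"
  obtains g \<chi> where "g \<in> carrier G" "\<chi> \<in> hom G complex_units"
    "\<And>x. x \<in> carrier G \<Longrightarrow> \<exists>k::nat. \<chi> x = \<chi> (g [^] k)"
    "\<And>(i::nat) (j::nat). \<chi> (g [^] i) = \<chi> (g [^] j) \<Longrightarrow> g [^] i = g [^] j"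
    "g = \<one> \<longrightarrow> carrier G = {\<one>}"
proof -
  interpret comm_group G by fact
  obtain g where g: "g \<in> carrier G" and gmax: "\<And>x. x \<in> carrier G \<Longrightarrow> ord x \<le> ord g"
  proof -
    have "Max (ord ` carrier G) \<in> ord ` carrier G"
      using G(2) one_closed by (intro Max_in) auto
    then obtain g where "g \<in> carrier G" "Max (ord ` carrier G) = ord g" by blast
    then show ?thesis using that[of g] G(2) by (metis Max_ge finite_imageI image_eqI)
  qed
  define N where "N = ord g"
  have N: "N > 0" using ord_ge_1[OF G(2) g] by (simp add: N_def)
  define \<zeta> where "\<zeta> = cis (2 * pi / real N)"
  have zeta_pow: "\<zeta> ^ i = 1 \<longleftrightarrow> N dvd i" for i
    unfolding \<zeta>_def by (rule cis_root_pow_eq_1_iff[OF N])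
  have zeta0: "\<zeta> \<noteq> 0" by (simp add: \<zeta>_def)
  have eq_le: "g [^] i = g [^] j \<longleftrightarrow> \<zeta> ^ i = \<zeta> ^ j" if "i \<le> j" for i j :: nat
  proof -
    have "g [^] j = g [^] i \<otimes> g [^] (j - i)" using that g by (simp add: nat_pow_mult)
    then have "g [^] i = g [^] j \<longleftrightarrow> g [^] (j - i) = \<one>" using g by (metis l_cancel_one nat_pow_closed)
    also have "\<dots> \<longleftrightarrow> \<zeta> ^ (j - i) = 1" using zeta_pow pow_eq_id[OF g] by (simp add: N_def)
    also have "\<dots> \<longleftrightarrow> \<zeta> ^ i = \<zeta> ^ j"
      using zeta0 that power_add[of \<zeta> i "j - i"] by auto
    finally show ?thesis .
  qed
  have eq: "g [^] i = g [^] j \<longleftrightarrow> \<zeta> ^ i = \<zeta> ^ j" for i j :: nat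
    using eq_le[of i j] eq_le[of j i] by (metis nat_le_linear)
  define C where "C = range (\<lambda>k::nat. g [^] k)"
  have C: "subgroup C G"
  proof (rule subgroupI)
    show "C \<subseteq> carrier G" "C \<noteq> {}" unfolding C_def using g by auto
  next
    fix a assume "a \<in> C"
    then obtain k :: nat where a: "a = g [^] k" unfolding C_def by auto
    have "g [^] k \<otimes> g [^] (N * k - k) = g [^] (N * k)"
      using g N by (simp add: nat_pow_mult)
    also have "\<dots> = \<one>" using g by (simp add: pow_eq_id N_def)
    finally have "inv a = g [^] (N * k - k)" using g a by (intro inv_equality) (simp_all add: m_comm)
    then show "inv a \<in> C" unfolding C_def by simp
  next
    fix a b assume "a \<in> C" "b \<in> C"
    then show "a \<otimes> b \<in> C" unfolding C_def using g by (auto simp: nat_pow_mult)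
  qed
  define \<phi> where "\<phi> x = \<zeta> ^ (SOME k::nat. x = g [^] k)" for x
  have phi: "\<phi> (g [^] k) = \<zeta> ^ k" for k :: nat
  proof -
    have "g [^] k = g [^] (SOME k'::nat. g [^] k = g [^] k')" by (rule someI) (rule refl)
    then show ?thesis unfolding \<phi>_def using eq by metis
  qed
  have "\<phi> \<in> hom (G\<lparr>carrier := C\<rparr>) complex_units"
    unfolding hom_complex_units_iff C_def using g zeta0 by (auto simp: phi nat_pow_mult power_add)
  then obtain \<chi> where chi: "\<chi> \<in> hom G complex_units" and ext: "\<And>h. h \<in> C \<Longrightarrow> \<chi> h = \<phi> h"
    using character_extension[OF G C] by blast
  have chig: "\<chi> (g [^] k) = \<zeta> ^ k" for k :: nat using ext phi by (auto simp: C_def)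
  define M where "M = card (\<chi> ` carrier G)"
  have img: "\<chi> ` carrier G = {z. z ^ M = 1}"
    using character_image[OF is_group G(2) chi] by (simp add: M_def)
  have M: "M > 0" using G(2) by (auto simp: M_def card_gt_0_iff)
  have "N dvd M" using img chig[of 1] g zeta_pow[of M] by auto
  have "cis (2 * pi / real M) \<in> \<chi> ` carrier G"
    using M unfolding img by (simp add: DeMoivre)
  then obtain y where y: "y \<in> carrier G" "\<chi> y = cis (2 * pi / real M)" by auto
  have "\<chi> y ^ ord y = 1" using char_pow[OF chi y(1), of "ord y"] y(1) char_one[OF chi] by simp
  then have "M dvd ord y" using y(2) cis_root_pow_eq_1_iff[OF M] by simp
  then have "M \<le> ord y" using ord_ge_1[OF G(2) y(1)] by (intro dvd_imp_le) auto
  then have "M = N" using gmax[OF y(1)] \<open>N dvd M\<close> M dvd_imp_le[of N M] by (simp add: N_def)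
  show ?thesis
  proof (rule that[OF g chi])
    fix x assume "x \<in> carrier G"
    then have "\<chi> x ^ N = 1" using img \<open>M = N\<close> by auto
    then obtain k where "\<chi> x = \<zeta> ^ k"
      using bij_betw_roots_unity[OF N] unfolding bij_betw_def \<zeta>_def
      by (auto simp: DeMoivre set_eq_iff image_iff mult_ac)
    then show "\<exists>k::nat. \<chi> x = \<chi> (g [^] k)" using chig by auto
  next
    fix i j :: nat assume "\<chi> (g [^] i) = \<chi> (g [^] j)"
    then show "g [^] i = g [^] j" using eq chig by simp
  next
    show "g = \<one> \<longrightarrow> carrier G = {\<one>}"
    proof
      assume "g = \<one>"
      then have "ord x = 1" if "x \<in> carrier G" for x
        using gmax[OF that] ord_ge_1[OF G(2) that] by simp
      then show "carrier G = {\<one>}" using ord_eq_1 by auto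
    qed
  qed
qed

text \<open>By induction on the order of the group. A splitting character \<open>\<chi>\<close> decomposes every \<open>x\<close> as \<open>g\<^sup>k h\<close> with
  \<open>h\<close> in the kernel of \<open>\<chi>\<close>; pairing the exponents of the cyclic parts through a root of unity \<open>\<chi> g\<close> and the
  kernel parts through the pairing of the kernel gives a pairing of the group. The root of unity to the
  power \<open>k x * k y\<close> is written as \<open>\<chi> y ^ k x\<close>, which makes multiplicativity in \<open>y\<close> immediate.\<close>

lemma ex_symmetric_pairing:
  assumes "comm_group G" "finite (carrier G)"
  shows "\<exists>B. symmetric_pairing G B"
  using assms
proof (induction "card (carrier G)" arbitrary: G rule: less_induct)
  case (less G)
  interpret comm_group G by fact
  note G = \<open>comm_group G\<close> \<open>finite (carrier G)\<close>
  show ?case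
  proof (cases "carrier G = {\<one>\<^bsub>G\<^esub>}")
    case True
    then have "symmetric_pairing G (\<lambda>_ _. 1)"
      by (auto simp: symmetric_pairing_def hom_complex_units_iff)
    then show ?thesis by blast
  next
    case False
    obtain g \<chi> where g: "g \<in> carrier G" and chi: "\<chi> \<in> hom G complex_units"
      and onto: "\<And>x. x \<in> carrier G \<Longrightarrow> \<exists>k::nat. \<chi> x = \<chi> (g [^]\<^bsub>G\<^esub> k)"
      and inj: "\<And>(i::nat) (j::nat). \<chi> (g [^]\<^bsub>G\<^esub> i) = \<chi> (g [^]\<^bsub>G\<^esub> j) \<Longrightarrow> g [^]\<^bsub>G\<^esub> i = g [^]\<^bsub>G\<^esub> j"
      and triv: "g = \<one>\<^bsub>G\<^esub> \<longrightarrow> carrier G = {\<one>\<^bsub>G\<^esub>}"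
      using ex_splitting_character[OF G] by blast
    note [simp] = char_mult[OF chi] char_inv[OF chi] char_pow[OF chi] char_one[OF chi] char_nonzero[OF chi]
    define H where "H = {x \<in> carrier G. \<chi> x = 1}"
    have H: "subgroup H G"
      by (rule subgroupI) (auto simp: H_def)
    let ?H = "G\<lparr>carrier := H\<rparr>"
    have "g \<notin> H"
    proof
      assume "g \<in> H"
      then have "g [^]\<^bsub>G\<^esub> (1::nat) = g [^]\<^bsub>G\<^esub> (0::nat)" using g by (intro inj) (simp add: H_def)
      then show False using g triv False by simp
    qed
    then have "H \<subset> carrier G" using g by (auto simp: H_def)
    then have card: "card (carrier ?H) < card (carrier G)" using G(2) by (simp add: psubset_card_mono)
    have comm: "comm_group ?H"
      using subgroup_imp_group[OF H] by (rule group.group_comm_groupI) (auto simp: H_def m_comm)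
    obtain B where B: "symmetric_pairing ?H B"
      using less.hyps[OF card comm] G(2) by (auto simp: H_def)
    have Bmult: "B x (y \<otimes>\<^bsub>G\<^esub> z) = B x y * B x z" if "x \<in> H" "y \<in> H" "z \<in> H" for x y z
      using B that by (auto simp: symmetric_pairing_def hom_complex_units_iff)
    have Bnz: "B x y \<noteq> 0" and Bsym: "B x y = B y x" if "x \<in> H" "y \<in> H" for x y
      using B that by (auto simp: symmetric_pairing_def hom_complex_units_iff)
    have Bnon: "x = \<one>\<^bsub>G\<^esub>" if "x \<in> H" "\<And>y. y \<in> H \<Longrightarrow> B x y = 1" for x
      using B that by (simp add: symmetric_pairing_def)
    have B1: "B x \<one>\<^bsub>G\<^esub> = 1" if "x \<in> H" for x
      using Bmult[OF that, of "\<one>\<^bsub>G\<^esub>" "\<one>\<^bsub>G\<^esub>"] Bnz[OF that, of "\<one>\<^bsub>G\<^esub>"] by (simp add: H_def)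
    \<comment> \<open>The exponent is determined only modulo the order of \<open>g\<close>; the power of \<open>g\<close>, and so \<open>h x\<close>, is unique.\<close>
    define k :: "'a \<Rightarrow> nat" where "k x = (SOME k. \<chi> x = \<chi> (g [^]\<^bsub>G\<^esub> k))" for x
    have k: "\<chi> x = \<chi> g ^ k x" if "x \<in> carrier G" for x
      using someI_ex[OF onto[OF that]] g by (simp add: k_def)
    define h where "h x = x \<otimes>\<^bsub>G\<^esub> inv\<^bsub>G\<^esub> (g [^]\<^bsub>G\<^esub> k x)" for x
    have hH: "h x \<in> H" if "x \<in> carrier G" for x
      using that g k[OF that] by (simp add: h_def H_def)
    have pow_eq: "g [^]\<^bsub>G\<^esub> i = g [^]\<^bsub>G\<^esub> j" if "\<chi> g ^ i = \<chi> g ^ j" for i j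
      using that g by (intro inj) simp
    have h_mult: "h (x \<otimes>\<^bsub>G\<^esub> y) = h x \<otimes>\<^bsub>G\<^esub> h y" if "x \<in> carrier G" "y \<in> carrier G" for x y
    proof -
      have "g [^]\<^bsub>G\<^esub> k (x \<otimes>\<^bsub>G\<^esub> y) = g [^]\<^bsub>G\<^esub> (k x + k y)"
        using that g k[of x] k[of y] k[of "x \<otimes>\<^bsub>G\<^esub> y"] by (intro pow_eq) (simp add: power_add)
      also have "\<dots> = g [^]\<^bsub>G\<^esub> k x \<otimes>\<^bsub>G\<^esub> g [^]\<^bsub>G\<^esub> k y" using g by (simp add: nat_pow_mult)
      finally show ?thesis using that g by (simp add: h_def inv_mult m_ac)
    qed
    have h_g: "h g = \<one>\<^bsub>G\<^esub>"
    proof -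
      have "g [^]\<^bsub>G\<^esub> k g = g [^]\<^bsub>G\<^esub> (1::nat)" using k[OF g] by (intro pow_eq) simp
      then show ?thesis using g by (simp add: h_def)
    qed
    have h_H: "h x = x" if "x \<in> H" for x
    proof -
      have "g [^]\<^bsub>G\<^esub> k x = g [^]\<^bsub>G\<^esub> (0::nat)" using k[of x] that by (intro pow_eq) (simp add: H_def)
      then show ?thesis using that by (simp add: h_def H_def)
    qed
    define C where "C x y = \<chi> y ^ k x * B (h x) (h y)" for x y
    have "symmetric_pairing G C"
      unfolding symmetric_pairing_def hom_complex_units_iff
    proof (intro conjI ballI impI)
      fix x y assume x: "x \<in> carrier G" and y: "y \<in> carrier G"
      show "C x y \<noteq> 0" using x y by (simp add: C_def hH Bnz)
      show "C x y = C y x"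
        using k[OF x] k[OF y] Bsym[OF hH[OF x] hH[OF y]]
        by (simp add: C_def mult.commute flip: power_mult)
      fix z assume z: "z \<in> carrier G"
      show "C x (y \<otimes>\<^bsub>G\<^esub> z) = C x y * C x z"
        using x y z by (simp add: C_def h_mult Bmult hH power_mult_distrib)
    next
      fix x assume x: "x \<in> carrier G" and one: "\<forall>y\<in>carrier G. C x y = 1"
      have "\<chi> g ^ k x = 1" using one g B1[OF hH[OF x]] by (auto simp: C_def h_g)
      then have "x \<in> H" using x k[OF x] by (simp add: H_def)
      moreover have "B x y = 1" if "y \<in> H" for y
        using one that \<open>x \<in> H\<close> by (auto simp: C_def h_H H_def)
      ultimately show "x = \<one>\<^bsub>G\<^esub>" by (rule Bnon)
    qed
    then show ?thesis by blast
  qed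
qed

locale finite_comm_group = comm_group G for G (structure) +
  assumes finite_carrier: "finite (carrier G)"
begin

definition pairing :: "'a \<Rightarrow> 'a \<Rightarrow> complex" where
  "pairing = (SOME B. symmetric_pairing G B)"

lemma symmetric_pairing: "symmetric_pairing G pairing"
  unfolding pairing_def using ex_symmetric_pairing[OF comm_group_axioms finite_carrier] by (rule someI_ex)

lemma pairing_hom: "x \<in> carrier G \<Longrightarrow> pairing x \<in> hom G complex_units"
  and pairing_commute: "x \<in> carrier G \<Longrightarrow> y \<in> carrier G \<Longrightarrow> pairing x y = pairing y x"
  and pairing_nondegenerate: "x \<in> carrier G \<Longrightarrow> (\<And>y. y \<in> carrier G \<Longrightarrow> pairing x y = 1) \<Longrightarrow> x = \<one>"
  using symmetric_pairing unfolding symmetric_pairing_def by blast+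

lemma pairing_mult_left:
  "x \<in> carrier G \<Longrightarrow> y \<in> carrier G \<Longrightarrow> z \<in> carrier G \<Longrightarrow> pairing (x \<otimes> y) z = pairing x z * pairing y z"
  using char_mult[OF pairing_hom, of z x y] by (simp add: pairing_commute)

lemma sum_pairing:
  assumes "x \<in> carrier G"
  shows "(\<Sum>y\<in>carrier G. pairing y x) = (if x = \<one> then of_nat (card (carrier G)) else 0)"
proof (cases "x = \<one>")
  case True
  then show ?thesis by (simp add: char_one pairing_hom)
next
  case False
  then obtain y where y: "y \<in> carrier G" "pairing x y \<noteq> 1"
    using pairing_nondegenerate[OF assms] by blast
  have "(\<Sum>y\<in>carrier G. pairing y x) = (\<Sum>y\<in>carrier G. pairing x y)"
    using assms by (simp add: pairing_commute)
  also have "\<dots> = 0"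
    using is_group pairing_hom[OF assms] y by (rule sum_character_eq_0)
  finally show ?thesis using False by simp
qed

lemma card_carrier_nonzero: "(of_nat (card (carrier G)) :: complex) \<noteq> 0"
  using finite_carrier one_closed by (auto simp: card_gt_0_iff)

text \<open>Fourier inversion: multiplying the transform at the character \<open>pairing y\<close> by \<open>pairing y (inv b)\<close> and
  summing over \<open>y\<close> leaves \<open>f b\<close> times the order of the group, by the orthogonality \<open>sum_pairing\<close>.\<close>

lemma fourier_injective:
  assumes f: "\<And>\<chi>. \<chi> \<in> carrier (character_group G) \<Longrightarrow> (\<Sum>a\<in>carrier G. f a * \<chi> a) = 0"
    and b: "b \<in> carrier G"
  shows "f b = 0"
proof -
  have f': "(\<Sum>a\<in>carrier G. f a * pairing y a) = 0" if y: "y \<in> carrier G" for y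
  proof -
    have "restrict (pairing y) (carrier G) \<in> carrier (character_group G)"
      using pairing_hom[OF y] by (auto simp: character_group_def hom_complex_units_iff)
    from f[OF this] show ?thesis by simp
  qed
  have "0 = (\<Sum>y\<in>carrier G. (\<Sum>a\<in>carrier G. f a * pairing y a) * pairing y (inv b))"
    by (simp add: f')
  also have "\<dots> = (\<Sum>y\<in>carrier G. \<Sum>a\<in>carrier G. f a * pairing y (a \<otimes> inv b))"
    using b by (intro sum.cong refl) (simp add: sum_distrib_right char_mult pairing_hom mult.assoc)
  also have "\<dots> = (\<Sum>a\<in>carrier G. f a * (\<Sum>y\<in>carrier G. pairing y (a \<otimes> inv b)))"
    by (subst sum.swap) (simp add: sum_distrib_left)
  also have "\<dots> = (\<Sum>a\<in>carrier G. if a = b then f b * of_nat (card (carrier G)) else 0)"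
  proof (intro sum.cong refl)
    fix a assume a: "a \<in> carrier G"
    have "a \<otimes> inv b = \<one> \<longleftrightarrow> a = b" using a b by (metis inv_closed inv_equality inv_inv r_inv)
    then show "f a * (\<Sum>y\<in>carrier G. pairing y (a \<otimes> inv b)) = (if a = b then f b * of_nat (card (carrier G)) else 0)"
      using a b by (simp add: sum_pairing)
  qed
  also have "\<dots> = f b * of_nat (card (carrier G))" using b finite_carrier by simp
  finally show ?thesis using card_carrier_nonzero by simp
qed

text \<open>If \<open>\<chi>\<close> differed from all characters \<open>pairing x\<close>, it would be orthogonal to each of them. Summing these
  orthogonality relations over \<open>x\<close> leaves only the term of the neutral element, which is the order of
  the group.\<close>

lemma character_eq_pairing:
  assumes chi: "\<chi> \<in> hom G complex_units"
  obtains x where "x \<in> carrier G" "\<And>y. y \<in> carrier G \<Longrightarrow> \<chi> y = pairing x y"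
proof -
  have "\<exists>x\<in>carrier G. \<forall>y\<in>carrier G. \<chi> y = pairing x y"
  proof (rule ccontr)
    assume none: "\<not> ?thesis"
    have 0: "(\<Sum>y\<in>carrier G. \<chi> y * inverse (pairing x y)) = 0" if x: "x \<in> carrier G" for x
    proof -
      have "\<exists>y\<in>carrier G. \<chi> y \<noteq> pairing x y" using none x by blast
      then obtain y where y: "y \<in> carrier G" "\<chi> y * inverse (pairing x y) \<noteq> 1"
        using char_nonzero[OF pairing_hom[OF x]] by (auto simp: field_simps)
      have "(\<lambda>y. \<chi> y * inverse (pairing x y)) \<in> hom G complex_units"
        using chi pairing_hom[OF x] by (auto simp: hom_complex_units_iff)
      from sum_character_eq_0[OF is_group this y] show ?thesis .
    qed
    have "0 = (\<Sum>x\<in>carrier G. \<Sum>y\<in>carrier G. \<chi> y * inverse (pairing x y))" by (simp add: 0)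
    also have "\<dots> = (\<Sum>y\<in>carrier G. \<chi> y * (\<Sum>x\<in>carrier G. pairing x (inv y)))"
      by (subst sum.swap) (simp add: sum_distrib_left char_inv pairing_hom)
    also have "\<dots> = (\<Sum>y\<in>carrier G. if y = \<one> then of_nat (card (carrier G)) else 0)"
      by (intro sum.cong refl) (simp add: sum_pairing inv_eq_1_iff char_one[OF chi])
    also have "\<dots> = of_nat (card (carrier G))" using finite_carrier by simp
    finally show False using card_carrier_nonzero by simp
  qed
  then show ?thesis using that by blast
qed

theorem character_group_iso: "character_group G \<cong> G"
proof -
  let ?f = "\<lambda>x. restrict (pairing x) (carrier G)"
  have "?f \<in> hom G (character_group G)"
  proof (rule homI)
    show "?f x \<in> carrier (character_group G)" if "x \<in> carrier G" for x
      using pairing_hom[OF that] by (auto simp: character_group_def hom_complex_units_iff)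
    show "?f (x \<otimes> y) = ?f x \<otimes>\<^bsub>character_group G\<^esub> ?f y" if "x \<in> carrier G" "y \<in> carrier G" for x y
      using that by (auto simp: character_group_def pairing_mult_left)
  qed
  moreover have "inj_on ?f (carrier G)"
  proof (rule inj_onI)
    fix x y assume x: "x \<in> carrier G" and y: "y \<in> carrier G" and "?f x = ?f y"
    then have "pairing x z = pairing y z" if "z \<in> carrier G" for z using that by (metis restrict_apply')
    then have "pairing z x = pairing z y" if "z \<in> carrier G" for z
      using that x y by (simp add: pairing_commute[of z])
    then have "pairing (x \<otimes> inv y) z = 1" if "z \<in> carrier G" for z
      using x y that char_nonzero[OF pairing_hom[OF that] y]
      by (simp add: pairing_commute[of "x \<otimes> inv y"] char_mult char_inv pairing_hom)
    then have "x \<otimes> inv y = \<one>" using x y by (intro pairing_nondegenerate) auto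
    then show "x = y" using x y by (metis inv_closed inv_equality inv_inv)
  qed
  moreover have "carrier (character_group G) \<subseteq> ?f ` carrier G"
  proof
    fix \<chi> assume chi: "\<chi> \<in> carrier (character_group G)"
    then have "\<chi> \<in> hom G complex_units" by (simp add: character_group_def)
    then obtain x where "x \<in> carrier G" "\<And>y. y \<in> carrier G \<Longrightarrow> \<chi> y = pairing x y"
      by (rule character_eq_pairing) blast
    moreover have "\<chi> \<in> extensional (carrier G)" using chi by (simp add: character_group_def)
    ultimately have "\<chi> = ?f x" by (intro extensionalityI[of _ "carrier G"]) auto
    then show "\<chi> \<in> ?f ` carrier G" using \<open>x \<in> carrier G\<close> by blast
  qed
  ultimately have "?f \<in> iso G (character_group G)"
    unfolding iso_def bij_betw_def using hom_carrier[of ?f G "character_group G"] by blast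
  then have "G \<cong> character_group G" by (auto simp: is_iso_def)
  then show ?thesis by (rule iso_sym)
qed

end

section \<open>Configurations\<close>

abbreviation amount :: "('v \<Rightarrow>\<^sub>0 int) \<Rightarrow> 'v \<Rightarrow> int" where
  "amount c v \<equiv> Poly_Mapping.lookup c v"

locale sandpile =
  fixes G :: "'v sandpile_graph"
  assumes sandpile_graph: "is_sandpile_graph G"
begin

abbreviation V where "V \<equiv> nonsink G"
abbreviation configs where "configs \<equiv> carrier (config_group G)"
abbreviation \<Delta> where "\<Delta> \<equiv> reduced_laplacian G"
abbreviation L where "L \<equiv> laplacian_lattice G"

lemma finite_verts: "finite (verts G)"
  and sink_in_verts: "sink G \<in> verts G"
  and edges_subset: "edges G \<subseteq> verts G \<times> verts G"
  and weight_pos_iff: "u \<in> verts G \<Longrightarrow> v \<in> verts G \<Longrightarrow> weight G u v > 0 \<longleftrightarrow> (u, v) \<in> edges G"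
  and sink_accessible: "v \<in> verts G \<Longrightarrow> (v, sink G) \<in> (edges G)\<^sup>*"
  using sandpile_graph unfolding is_sandpile_graph_def is_multigraph_def by auto

lemma finite_V [simp]: "finite V"
  using finite_verts by (simp add: nonsink_def)

lemma in_configs_iff: "c \<in> configs \<longleftrightarrow> Poly_Mapping.keys c \<subseteq> V"
  by simp

lemma zero_config [simp]: "0 \<in> configs"
  and add_config [simp]: "c \<in> configs \<Longrightarrow> d \<in> configs \<Longrightarrow> c + d \<in> configs"
  and diff_config [simp]: "c \<in> configs \<Longrightarrow> d \<in> configs \<Longrightarrow> c - d \<in> configs"
  and minus_config [simp]: "c \<in> configs \<Longrightarrow> - c \<in> configs"
  and frag_of_config [simp]: "v \<in> V \<Longrightarrow> frag_of v \<in> configs"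
  and cmul_config [simp]: "c \<in> configs \<Longrightarrow> frag_cmul k c \<in> configs"
  unfolding in_configs_iff
  using Poly_Mapping.keys_add[of c d] Poly_Mapping.keys_diff[of c d] keys_cmul[of k c]
  by auto

lemma sum_config [simp]: "(\<And>i. i \<in> I \<Longrightarrow> f i \<in> configs) \<Longrightarrow> sum f I \<in> configs"
  by (induction I rule: infinite_finite_induct) (simp_all del: carrier_free_Abelian_group_iff)

lemma amount_outside: "c \<in> configs \<Longrightarrow> v \<notin> V \<Longrightarrow> amount c v = 0"
  by (auto simp: in_keys_iff)

lemma config_eqI: "c \<in> configs \<Longrightarrow> d \<in> configs \<Longrightarrow> (\<And>v. v \<in> V \<Longrightarrow> amount c v = amount d v) \<Longrightarrow> c = d"
  by (rule poly_mapping_eqI) (metis amount_outside)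

declare carrier_free_Abelian_group_iff [simp del]

definition config_of :: "('v \<Rightarrow> int) \<Rightarrow> ('v \<Rightarrow>\<^sub>0 int)" where
  "config_of f = (\<Sum>v\<in>V. frag_cmul (f v) (frag_of v))"

lemma config_of_config [simp]: "config_of f \<in> configs"
  by (simp add: config_of_def)

lemma amount_config_of [simp]: "v \<in> V \<Longrightarrow> amount (config_of f) v = f v"
  by (simp add: config_of_def lookup_sum if_distrib[of "(*) _"] cong: if_cong)

lemma nonneg_config_iff: "nonneg_config G c \<longleftrightarrow> c \<in> configs \<and> (\<forall>v\<in>V. amount c v \<ge> 0)"
  by (simp add: nonneg_config_def)

lemma stable_config_iff: "stable_config G c \<longleftrightarrow> c \<in> configs \<and> (\<forall>v\<in>V. amount c v < int (outdeg G v))"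
  by (simp add: stable_config_def)

section \<open>The reduced Laplacian\<close>

lemma laplacian_0 [simp]: "\<Delta> 0 = 0"
  and laplacian_add: "\<Delta> (\<sigma> + \<tau>) = \<Delta> \<sigma> + \<Delta> \<tau>"
  and laplacian_diff: "\<Delta> (\<sigma> - \<tau>) = \<Delta> \<sigma> - \<Delta> \<tau>"
  and laplacian_minus: "\<Delta> (- \<sigma>) = - \<Delta> \<sigma>"
  by (simp_all add: reduced_laplacian_def frag_extend_add frag_extend_diff frag_extend_minus)

lemma laplacian_config [simp]: "\<sigma> \<in> configs \<Longrightarrow> \<Delta> \<sigma> \<in> configs"
  unfolding reduced_laplacian_def frag_extend_def
  by (intro sum_config cmul_config diff_config frag_of_config) (auto simp: in_configs_iff)

lemma amount_laplacian:
  assumes "\<sigma> \<in> configs" "u \<in> V"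
  shows "amount (\<Delta> \<sigma>) u = amount \<sigma> u * int (outdeg G u) - (\<Sum>v\<in>V. amount \<sigma> v * int (weight G v u))"
proof -
  have "\<Delta> \<sigma> = (\<Sum>v\<in>V. frag_cmul (amount \<sigma> v)
          (frag_cmul (int (outdeg G v)) (frag_of v) - (\<Sum>u\<in>V. frag_cmul (int (weight G v u)) (frag_of u))))"
    unfolding reduced_laplacian_def frag_extend_def
    using assms(1) by (intro sum.mono_neutral_left) (auto simp: in_configs_iff in_keys_iff)
  also have "amount \<dots> u = (\<Sum>v\<in>V. amount \<sigma> v * ((if u = v then int (outdeg G v) else 0) - int (weight G v u)))"
    using assms(2)
    by (simp add: lookup_sum lookup_minus if_distrib[of "(*) _"] cong: if_cong) 
  also have "\<dots> = (\<Sum>v\<in>V. if v = u then amount \<sigma> u * int (outdeg G u) else 0) - (\<Sum>v\<in>V. amount \<sigma> v * int (weight G v u))"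
    by (simp add: right_diff_distrib sum_subtractf if_distrib[of "(*) _"] cong: if_cong)
  also have "(\<Sum>v\<in>V. if v = u then amount \<sigma> u * int (outdeg G u) else 0) = amount \<sigma> u * int (outdeg G u)"
    using assms(2) by simp
  finally show ?thesis .
qed

text \<open>Summation by parts: the effect of firings on a linear function of configurations is read off from
  the effect of a single firing of each vertex.\<close>

lemma sum_laplacian:
  assumes "\<sigma> \<in> configs"
  shows "(\<Sum>u\<in>V. f u * amount (\<Delta> \<sigma>) u)
    = (\<Sum>v\<in>V. amount \<sigma> v * (f v * int (outdeg G v) - (\<Sum>u\<in>V. int (weight G v u) * f u)))"
proof -
  have "(\<Sum>u\<in>V. f u * amount (\<Delta> \<sigma>) u)
    = (\<Sum>u\<in>V. amount \<sigma> u * (f u * int (outdeg G u))) - (\<Sum>u\<in>V. \<Sum>v\<in>V. amount \<sigma> v * (int (weight G v u) * f u))"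
    using assms by (simp add: amount_laplacian right_diff_distrib sum_subtractf sum_distrib_left mult_ac)
  also have "(\<Sum>u\<in>V. \<Sum>v\<in>V. amount \<sigma> v * (int (weight G v u) * f u))
    = (\<Sum>v\<in>V. amount \<sigma> v * (\<Sum>u\<in>V. int (weight G v u) * f u))"
    by (subst sum.swap) (simp add: sum_distrib_left)
  finally show ?thesis by (simp add: right_diff_distrib sum_subtractf)
qed

lemma amount_laplacian_le:
  assumes "nonneg_config G \<sigma>" "v \<in> V"
  shows "amount (\<Delta> \<sigma>) v \<le> amount \<sigma> v * int (outdeg G v)"
  using assms sum_nonneg[of V "\<lambda>w. amount \<sigma> w * int (weight G w v)"]
  by (simp add: amount_laplacian nonneg_config_iff)

lemma sum_weight_V: "int (outdeg G v) = int (weight G v (sink G)) + (\<Sum>u\<in>V. int (weight G v u))"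
  using finite_verts sink_in_verts by (simp add: outdeg_def nonsink_def sum.remove)

lemma config_deg_add: "config_deg G (c + d) = config_deg G c + config_deg G d"
  and config_deg_diff: "config_deg G (c - d) = config_deg G c - config_deg G d"
  by (simp_all add: config_deg_def lookup_add lookup_minus sum.distrib sum_subtractf)

text \<open>Firing \<open>v\<close> loses the grains that go to the sink.\<close>

lemma config_deg_laplacian_nonneg:
  assumes "nonneg_config G \<sigma>"
  shows "config_deg G (\<Delta> \<sigma>) \<ge> 0"
proof -
  have "config_deg G (\<Delta> \<sigma>) = (\<Sum>v\<in>V. amount \<sigma> v * int (weight G v (sink G)))"
    using sum_laplacian[of \<sigma> "\<lambda>_. 1"] assms by (simp add: config_deg_def nonneg_config_iff sum_weight_V)
  then show ?thesis using assms by (auto intro!: sum_nonneg simp: nonneg_config_iff)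
qed

section \<open>A potential that every firing decreases\<close>

definition dist_sink :: "'v \<Rightarrow> nat" where
  "dist_sink v = (LEAST k. (v, sink G) \<in> edges G ^^ k)"

lemma dist_sink_sink: "dist_sink (sink G) = 0"
  unfolding dist_sink_def by (rule Least_eq_0) simp

lemma closer_neighbour:
  assumes "v \<in> V"
  obtains u where "u \<in> verts G" "weight G v u > 0" "dist_sink u < dist_sink v"
proof -
  have v: "v \<in> verts G" "v \<noteq> sink G" using assms by (auto simp: nonsink_def)
  have "\<exists>k. (v, sink G) \<in> edges G ^^ k" using sink_accessible[OF v(1)] rtrancl_power by metis
  then have path: "(v, sink G) \<in> edges G ^^ dist_sink v" unfolding dist_sink_def by (rule LeastI_ex)
  with v(2) obtain k where k: "dist_sink v = Suc k" by (cases "dist_sink v") auto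
  then obtain u where u: "(v, u) \<in> edges G" "(u, sink G) \<in> edges G ^^ k"
    using path by (metis relpow_Suc_D2)
  have "dist_sink u \<le> k" unfolding dist_sink_def using u(2) by (rule Least_le)
  moreover have "u \<in> verts G" using u(1) edges_subset by auto
  ultimately show ?thesis using that[of u] u(1) v(1) k weight_pos_iff[of v u] by simp
qed

definition potential_base :: int where
  "potential_base = 1 + (\<Sum>v\<in>verts G. int (outdeg G v))"

definition dist_bound :: nat where
  "dist_bound = (\<Sum>v\<in>verts G. dist_sink v)"

text \<open>The height grows with the distance to the sink, but by geometrically decreasing steps. One edge
  towards the sink therefore outweighs all edges that lead further away.\<close>

definition height :: "'v \<Rightarrow> int" where
  "height v = potential_base ^ dist_bound - potential_base ^ (dist_bound - dist_sink v)"

lemma potential_base_ge: "v \<in> verts G \<Longrightarrow> int (outdeg G v) + 1 \<le> potential_base"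
  unfolding potential_base_def
  using finite_verts member_le_sum[of v "verts G" "\<lambda>v. int (outdeg G v)"] by simp

lemma potential_base_pos: "potential_base \<ge> 1"
  unfolding potential_base_def by (simp add: sum_nonneg)

lemma dist_sink_le_bound: "v \<in> verts G \<Longrightarrow> dist_sink v \<le> dist_bound"
  unfolding dist_bound_def using finite_verts by (simp add: member_le_sum)

lemma height_nonneg: "height v \<ge> 0"
  unfolding height_def using potential_base_pos by (simp add: power_increasing)

lemma height_superharmonic:
  assumes v: "v \<in> V"
  shows "height v * int (outdeg G v) - (\<Sum>u\<in>V. int (weight G v u) * height u) \<ge> 1"
proof -
  let ?B = potential_base and ?M = dist_bound and ?w = "\<lambda>u. int (weight G v u)"
  have vv: "v \<in> verts G" using v by (auto simp: nonsink_def)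
  obtain u where u: "u \<in> verts G" "weight G v u > 0" "dist_sink u < dist_sink v"
    using closer_neighbour[OF v] .
  \<comment> \<open>The sink has height 0 and may be included in the sum.\<close>
  have "(\<Sum>u\<in>V. ?w u * height u) = (\<Sum>u\<in>verts G. ?w u * height u)"
    unfolding nonsink_def using finite_verts
    by (intro sum.mono_neutral_left) (auto simp: height_def dist_sink_sink)
  also have "\<dots> = int (outdeg G v) * ?B ^ ?M - (\<Sum>u\<in>verts G. ?w u * ?B ^ (?M - dist_sink u))"
    by (simp add: height_def right_diff_distrib sum_subtractf outdeg_def sum_distrib_right)
  finally have eq: "height v * int (outdeg G v) - (\<Sum>u\<in>V. ?w u * height u)
    = (\<Sum>u\<in>verts G. ?w u * ?B ^ (?M - dist_sink u)) - int (outdeg G v) * ?B ^ (?M - dist_sink v)"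
    by (simp add: height_def algebra_simps)
  have "?B * ?B ^ (?M - dist_sink v) = ?B ^ Suc (?M - dist_sink v)" by simp
  also have "\<dots> \<le> ?B ^ (?M - dist_sink u)"
    using potential_base_pos u dist_sink_le_bound[OF vv] by (intro power_increasing) auto
  also have "\<dots> \<le> ?w u * ?B ^ (?M - dist_sink u)"
    using u(2) potential_base_pos by (simp add: mult_le_cancel_right1)
  also have "\<dots> \<le> (\<Sum>u\<in>verts G. ?w u * ?B ^ (?M - dist_sink u))"
    using finite_verts u(1) potential_base_pos by (intro member_le_sum) auto
  finally have "(?B - int (outdeg G v)) * ?B ^ (?M - dist_sink v)
    \<le> height v * int (outdeg G v) - (\<Sum>u\<in>V. ?w u * height u)"
    unfolding eq by (simp add: left_diff_distrib)
  moreover have "1 * 1 \<le> (?B - int (outdeg G v)) * ?B ^ (?M - dist_sink v)"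
    using potential_base_ge[OF vv] potential_base_pos by (intro mult_mono) auto
  ultimately show ?thesis by simp
qed

definition potential :: "('v \<Rightarrow>\<^sub>0 int) \<Rightarrow> int" where
  "potential c = (\<Sum>v\<in>V. height v * amount c v)"

lemma potential_diff: "potential (c - d) = potential c - potential d"
  by (simp add: potential_def lookup_minus right_diff_distrib sum_subtractf)

lemma potential_nonneg: "nonneg_config G c \<Longrightarrow> potential c \<ge> 0"
  by (simp add: potential_def nonneg_config_iff sum_nonneg height_nonneg)

lemma potential_laplacian:
  assumes "nonneg_config G \<sigma>" "v \<in> V"
  shows "potential (\<Delta> \<sigma>) \<ge> amount \<sigma> v"
proof -
  have \<sigma>: "\<sigma> \<in> configs" "\<And>v. v \<in> V \<Longrightarrow> amount \<sigma> v \<ge> 0" using assms(1) by (auto simp: nonneg_config_iff)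
  have "amount \<sigma> v \<le> (\<Sum>v\<in>V. amount \<sigma> v)"
    using assms(2) \<sigma>(2) by (intro member_le_sum) auto
  moreover have "(\<Sum>v\<in>V. amount \<sigma> v) \<le> (\<Sum>v\<in>V. amount \<sigma> v * (height v * int (outdeg G v) - (\<Sum>u\<in>V. int (weight G v u) * height u)))"
    using mult_left_mono[OF height_superharmonic \<sigma>(2)] by (intro sum_mono) auto
  moreover have "\<dots> = potential (\<Delta> \<sigma>)" using \<sigma>(1) by (simp add: potential_def sum_laplacian)
  ultimately show ?thesis by linarith
qed

lemma potential_laplacian_pos:
  assumes "nonneg_config G \<sigma>" "\<sigma> \<noteq> 0"
  shows "potential (\<Delta> \<sigma>) > 0"
proof -
  obtain v where v: "v \<in> V" "amount \<sigma> v \<noteq> 0"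
    using config_eqI[of \<sigma> 0] assms by (auto simp: nonneg_config_iff)
  then have "amount \<sigma> v > 0" using assms by (simp add: nonneg_config_iff less_le)
  then show ?thesis using potential_laplacian[OF assms(1) v(1)] by linarith
qed

lemma outdeg_pos: "v \<in> V \<Longrightarrow> outdeg G v > 0"
  using closer_neighbour[of v] finite_verts by (metis gr0I less_nat_zero_code outdeg_def sum_eq_0_iff)

lemma frag_of_nonneg [simp]: "v \<in> V \<Longrightarrow> nonneg_config G (frag_of v)"
  by (simp add: nonneg_config_iff)

lemma nonneg_add: "nonneg_config G c \<Longrightarrow> nonneg_config G d \<Longrightarrow> nonneg_config G (c + d)"
  by (simp add: nonneg_config_iff lookup_add)

section \<open>The lattice of the reduced Laplacian\<close>

lemma lattice_config: "x \<in> L \<Longrightarrow> x \<in> configs"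
  and lattice_0 [simp]: "0 \<in> L"
  and lattice_add: "x \<in> L \<Longrightarrow> y \<in> L \<Longrightarrow> x + y \<in> L"
  and lattice_diff: "x \<in> L \<Longrightarrow> y \<in> L \<Longrightarrow> x - y \<in> L"
  and lattice_minus: "x \<in> L \<Longrightarrow> - x \<in> L"
  and laplacian_in_lattice [simp]: "\<sigma> \<in> configs \<Longrightarrow> \<Delta> \<sigma> \<in> L"
proof -
  show "x \<in> L \<Longrightarrow> x \<in> configs" by (auto simp: laplacian_lattice_def)
  show "\<sigma> \<in> configs \<Longrightarrow> \<Delta> \<sigma> \<in> L" by (simp add: laplacian_lattice_def)
  show "0 \<in> L" unfolding laplacian_lattice_def using zero_config laplacian_0 by (metis image_eqI)
  show "x \<in> L \<Longrightarrow> y \<in> L \<Longrightarrow> x + y \<in> L"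
    unfolding laplacian_lattice_def using add_config laplacian_add by (auto simp flip: laplacian_add)
  show "x \<in> L \<Longrightarrow> y \<in> L \<Longrightarrow> x - y \<in> L"
    unfolding laplacian_lattice_def by (auto simp flip: laplacian_diff)
  show "x \<in> L \<Longrightarrow> - x \<in> L"
    unfolding laplacian_lattice_def by (auto simp flip: laplacian_minus)
qed

lemma lattice_sum: "(\<And>i. i \<in> I \<Longrightarrow> f i \<in> L) \<Longrightarrow> sum f I \<in> L"
  by (induction I rule: infinite_finite_induct) (simp_all add: lattice_add)

lemma lattice_cmul:
  assumes "x \<in> L"
  shows "frag_cmul k x \<in> L"
proof -
  obtain \<sigma> where "\<sigma> \<in> configs" "x = \<Delta> \<sigma>" using assms by (auto simp: laplacian_lattice_def)
  then have "frag_cmul k x = \<Delta> (frag_cmul k \<sigma>)" "frag_cmul k \<sigma> \<in> configs"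
    by (simp_all add: reduced_laplacian_def frag_extend_cmul)
  then show ?thesis by simp
qed

lemma lattice_trans: "x - y \<in> L \<Longrightarrow> y - z \<in> L \<Longrightarrow> x - z \<in> L"
  using lattice_add[of "x - y" "y - z"] by simp

lemma lattice_commute: "x - y \<in> L \<Longrightarrow> y - x \<in> L"
  using lattice_minus[of "x - y"] by simp

section \<open>Superstable configurations\<close>

lemma superstable_iff:
  "c \<in> superstable_configs G \<longleftrightarrow> nonneg_config G c
     \<and> (\<forall>\<sigma>. nonneg_config G \<sigma> \<longrightarrow> nonneg_config G (c - \<Delta> \<sigma>) \<longrightarrow> \<sigma> = 0)"
  by (auto simp: superstable_configs_def)

text \<open>As long as a configuration is not superstable, some nonempty collection of firings keeps it nonnegative;
  this lowers
  the potential and does not raise the degree.\<close>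

lemma ex_superstable_below:
  assumes "nonneg_config G c"
  obtains s where "s \<in> superstable_configs G" "c - s \<in> L" "config_deg G s \<le> config_deg G c"
proof -
  have "\<exists>s \<in> superstable_configs G. c - s \<in> L \<and> config_deg G s \<le> config_deg G c"
    using assms
  proof (induction "nat (potential c)" arbitrary: c rule: less_induct)
    case (less c)
    show ?case
    proof (cases "c \<in> superstable_configs G")
      case True
      then show ?thesis by (intro bexI[of _ c]) auto
    next
      case False
      then obtain \<sigma> where \<sigma>: "nonneg_config G \<sigma>" "nonneg_config G (c - \<Delta> \<sigma>)" "\<sigma> \<noteq> 0"
        using less.prems by (auto simp: superstable_iff)
      have "nat (potential (c - \<Delta> \<sigma>)) < nat (potential c)"
        using potential_laplacian_pos[OF \<sigma>(1,3)] potential_nonneg[OF \<sigma>(2)] by (simp add: potential_diff)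
      from less.hyps[OF this \<sigma>(2)] obtain s where s: "s \<in> superstable_configs G"
        "c - \<Delta> \<sigma> - s \<in> L" "config_deg G s \<le> config_deg G (c - \<Delta> \<sigma>)" by blast
      have "c - s = (c - \<Delta> \<sigma> - s) + \<Delta> \<sigma>" by simp
      also have "\<dots> \<in> L" using s(2) \<sigma>(1) by (intro lattice_add) (auto simp: nonneg_config_iff)
      finally show ?thesis using s config_deg_laplacian_nonneg[OF \<sigma>(1)] by (auto simp: config_deg_diff)
    qed
  qed
  then show ?thesis using that by blast
qed

text \<open>If \<open>c - d = \<Delta> \<sigma>\<close> and \<open>P\<close>, \<open>Q\<close> are the positive and the negative part of \<open>\<sigma>\<close>, then \<open>c - \<Delta> P = d - \<Delta> Q\<close> is
  nonnegative: at each vertex one of \<open>P\<close> and \<open>Q\<close> is zero, and firing the other vertices only adds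
  grains there. Superstability of \<open>c\<close> and of \<open>d\<close> forces \<open>P = 0\<close> and \<open>Q = 0\<close>.\<close>

lemma superstable_unique:
  assumes c: "c \<in> superstable_configs G" and d: "d \<in> superstable_configs G" and "c - d \<in> L"
  shows "c = d"
proof -
  obtain \<sigma> where \<sigma>: "\<sigma> \<in> configs" "c - d = \<Delta> \<sigma>" using assms(3) by (auto simp: laplacian_lattice_def)
  have cc: "c \<in> configs" "\<And>v. v \<in> V \<Longrightarrow> amount c v \<ge> 0" "d \<in> configs" "\<And>v. v \<in> V \<Longrightarrow> amount d v \<ge> 0"
    using c d by (auto simp: superstable_iff nonneg_config_iff)
  define P where "P = config_of (\<lambda>v. max 0 (amount \<sigma> v))"
  define Q where "Q = config_of (\<lambda>v. max 0 (- amount \<sigma> v))"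
  have PQ: "nonneg_config G P" "nonneg_config G Q" by (auto simp: nonneg_config_iff P_def Q_def)
  have "\<sigma> = P - Q" using \<sigma>(1) by (intro config_eqI) (auto simp: P_def Q_def lookup_minus)
  then have eq: "c - \<Delta> P = d - \<Delta> Q" using \<sigma>(2) by (simp add: laplacian_diff) (simp add: algebra_simps)
  have PQc: "P \<in> configs" "Q \<in> configs" by (auto simp: P_def Q_def)
  have "amount (c - \<Delta> P) v \<ge> 0" if v: "v \<in> V" for v
  proof (cases "amount \<sigma> v \<le> 0")
    case True
    then have "amount P v = 0" using v by (simp add: P_def)
    then show ?thesis using amount_laplacian_le[OF PQ(1) v] cc(2)[OF v] by (simp add: lookup_minus)
  next
    case False
    then have "amount Q v = 0" using v by (simp add: Q_def)
    then show ?thesis unfolding eq using amount_laplacian_le[OF PQ(2) v] cc(4)[OF v] by (simp add: lookup_minus)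
  qed
  then have nn: "nonneg_config G (c - \<Delta> P)" using cc PQc by (simp add: nonneg_config_iff)
  have "P = 0" using c PQ(1) nn by (auto simp: superstable_iff)
  moreover have "Q = 0" using d PQ(2) nn unfolding eq by (auto simp: superstable_iff)
  ultimately show ?thesis using eq by simp
qed

end

context sandpile
begin

section \<open>Toppling and stabilization\<close>

text \<open>The least action principle: legal firings fire no vertex more often than any other firings that lead
  to a stable configuration, legal or not.\<close>

lemma topples_script:
  assumes "topples_to G c c'" "c \<in> configs"
  obtains \<sigma> where "nonneg_config G \<sigma>" "c' = c - \<Delta> \<sigma>"
    "\<And>\<tau> v. nonneg_config G \<tau> \<Longrightarrow> stable_config G (c - \<Delta> \<tau>) \<Longrightarrow> v \<in> V \<Longrightarrow> amount \<sigma> v \<le> amount \<tau> v"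
proof -
  have "\<exists>\<sigma>. nonneg_config G \<sigma> \<and> c' = c - \<Delta> \<sigma> \<and>
    (\<forall>\<tau>. nonneg_config G \<tau> \<longrightarrow> stable_config G (c - \<Delta> \<tau>) \<longrightarrow> (\<forall>v\<in>V. amount \<sigma> v \<le> amount \<tau> v))"
    using assms(1) unfolding topples_to_def
  proof (induction rule: rtranclp_induct)
    case base
    show ?case by (intro exI[of _ 0]) (auto simp: nonneg_config_iff)
  next
    case (step y z)
    then obtain \<sigma> where \<sigma>: "nonneg_config G \<sigma>" "y = c - \<Delta> \<sigma>"
      and least: "\<And>\<tau> v. nonneg_config G \<tau> \<Longrightarrow> stable_config G (c - \<Delta> \<tau>) \<Longrightarrow> v \<in> V \<Longrightarrow> amount \<sigma> v \<le> amount \<tau> v"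
      by blast
    from step.hyps obtain u where u: "u \<in> V" "int (outdeg G u) \<le> amount y u" "z = y - \<Delta> (frag_of u)"
      by (auto simp: legal_firing_def)
    show ?case
    proof (intro exI[of _ "\<sigma> + frag_of u"] conjI allI impI ballI)
      show "nonneg_config G (\<sigma> + frag_of u)" using \<sigma>(1) u(1) by (intro nonneg_add) auto
      show "z = c - \<Delta> (\<sigma> + frag_of u)" using u(3) \<sigma>(2) by (simp add: laplacian_add)
      fix \<tau> v assume \<tau>: "nonneg_config G \<tau>" "stable_config G (c - \<Delta> \<tau>)" and v: "v \<in> V"
      have le: "amount \<sigma> w \<le> amount \<tau> w" if "w \<in> V" for w using least[OF \<tau> that] .
      \<comment> \<open>The vertex fired last was unstable, so \<open>\<tau>\<close> has to fire it once more than \<open>\<sigma>\<close> does.\<close>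
      have "amount \<sigma> u \<noteq> amount \<tau> u"
      proof
        assume eq: "amount \<sigma> u = amount \<tau> u"
        have "nonneg_config G (\<tau> - \<sigma>)"
          using \<tau>(1) \<sigma>(1) le by (auto simp: nonneg_config_iff lookup_minus)
        from amount_laplacian_le[OF this u(1)] have "amount (\<Delta> \<tau>) u \<le> amount (\<Delta> \<sigma>) u"
          using eq by (simp add: laplacian_diff lookup_minus)
        then show False using u(1,2) \<tau>(2) \<sigma>(2) by (auto simp: stable_config_iff lookup_minus)
      qed
      then show "amount (\<sigma> + frag_of u) v \<le> amount \<tau> v"
        using le[OF v] le[OF u(1)] by (auto simp: lookup_add)
    qed
  qed
  then show ?thesis using that by blast
qed

lemma topples_congruent:
  assumes "topples_to G c c'" "c \<in> configs"
  shows "c' \<in> configs" "c - c' \<in> L"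
proof -
  obtain \<sigma> where "nonneg_config G \<sigma>" "c' = c - \<Delta> \<sigma>" using topples_script[OF assms] by metis
  then show "c' \<in> configs" "c - c' \<in> L" using assms(2) by (simp_all add: nonneg_config_iff)
qed

text \<open>By the least action principle each of the two scripts is below the other.\<close>

lemma stabilization_unique:
  assumes "c \<in> configs" "topples_to G c c'" "stable_config G c'" "topples_to G c c''" "stable_config G c''"
  shows "c' = c''"
proof -
  obtain \<sigma> where \<sigma>: "nonneg_config G \<sigma>" "c' = c - \<Delta> \<sigma>"
    "\<And>\<tau> v. nonneg_config G \<tau> \<Longrightarrow> stable_config G (c - \<Delta> \<tau>) \<Longrightarrow> v \<in> V \<Longrightarrow> amount \<sigma> v \<le> amount \<tau> v"
    using topples_script[OF assms(2,1)] by metis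
  obtain \<tau> where \<tau>: "nonneg_config G \<tau>" "c'' = c - \<Delta> \<tau>"
    "\<And>\<sigma> v. nonneg_config G \<sigma> \<Longrightarrow> stable_config G (c - \<Delta> \<sigma>) \<Longrightarrow> v \<in> V \<Longrightarrow> amount \<tau> v \<le> amount \<sigma> v"
    using topples_script[OF assms(4,1)] by metis
  have "\<sigma> = \<tau>"
  proof (rule config_eqI)
    show "amount \<sigma> v = amount \<tau> v" if "v \<in> V" for v
      using \<sigma>(3)[OF \<tau>(1) _ that] \<tau>(3)[OF \<sigma>(1) _ that] \<sigma>(2) \<tau>(2) assms(3,5) by simp
  qed (use \<sigma> \<tau> in \<open>auto simp: nonneg_config_iff\<close>)
  then show ?thesis using \<sigma> \<tau> by simp
qed

lemma legal_firing_nonneg: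
  assumes "legal_firing G c c'" "nonneg_config G c"
  shows "nonneg_config G c'"
proof -
  obtain u where u: "u \<in> V" "int (outdeg G u) \<le> amount c u" "c' = c - \<Delta> (frag_of u)"
    using assms(1) by (auto simp: legal_firing_def)
  have "amount c' v \<ge> 0" if v: "v \<in> V" for v
    using amount_laplacian_le[OF frag_of_nonneg[OF u(1)] v] u(2,3) assms(2) v
    by (cases "v = u") (auto simp: lookup_minus nonneg_config_iff)
  then show ?thesis using assms(2) u by (simp add: nonneg_config_iff)
qed

lemma topples_nonneg:
  assumes "topples_to G c c'" "nonneg_config G c"
  shows "nonneg_config G c'"
  using assms unfolding topples_to_def by (induction rule: rtranclp_induct) (auto intro: legal_firing_nonneg)

lemma topples_trans: "topples_to G a b \<Longrightarrow> topples_to G b c \<Longrightarrow> topples_to G a c"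
  unfolding topples_to_def by (rule rtranclp_trans)

lemma topples_add:
  assumes "topples_to G c c'" "nonneg_config G b"
  shows "topples_to G (c + b) (c' + b)"
  using assms(1) unfolding topples_to_def
proof (induction rule: rtranclp_induct)
  case (step y z)
  then obtain u where u: "u \<in> V" "int (outdeg G u) \<le> amount y u" "z = y - \<Delta> (frag_of u)"
    by (auto simp: legal_firing_def)
  then have "legal_firing G (y + b) (z + b)"
    unfolding legal_firing_def using assms(2)
    by (intro bexI[of _ u]) (auto simp: lookup_add nonneg_config_iff add_increasing2)
  with step.IH show ?case by (rule rtranclp.rtrancl_into_rtrancl)
qed simp

lemma stabilizes:
  assumes "nonneg_config G c"
  shows "\<exists>c'. topples_to G c c' \<and> stable_config G c'"
  using assms
proof (induction "nat (potential c)" arbitrary: c rule: less_induct)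
  case (less c)
  show ?case
  proof (cases "stable_config G c")
    case True
    then show ?thesis by (auto simp: topples_to_def)
  next
    case False
    then obtain u where u: "u \<in> V" "int (outdeg G u) \<le> amount c u"
      using less.prems by (auto simp: stable_config_iff nonneg_config_iff not_less)
    let ?d = "c - \<Delta> (frag_of u)"
    have fire: "legal_firing G c ?d" using u by (auto simp: legal_firing_def)
    have d: "nonneg_config G ?d" using fire less.prems by (rule legal_firing_nonneg)
    have "nat (potential ?d) < nat (potential c)"
      using potential_laplacian_pos[OF frag_of_nonneg[OF u(1)]] potential_nonneg[OF d]
      by (simp add: potential_diff)
    from less.hyps[OF this d] show ?thesis
      using fire unfolding topples_to_def by (meson converse_rtranclp_into_rtranclp)
  qed
qed

lemma stabilization:
  assumes "nonneg_config G c"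
  shows "topples_to G c (stabilization G c)" "stable_config G (stabilization G c)"
    "nonneg_config G (stabilization G c)" "c - stabilization G c \<in> L"
proof -
  have c: "c \<in> configs" using assms by (simp add: nonneg_config_iff)
  have "\<exists>!c'. topples_to G c c' \<and> stable_config G c'"
    using stabilizes[OF assms] stabilization_unique[OF c] by blast
  then have "topples_to G c (stabilization G c) \<and> stable_config G (stabilization G c)"
    unfolding stabilization_def by (rule theI')
  then show *: "topples_to G c (stabilization G c)" "stable_config G (stabilization G c)" by auto
  show "nonneg_config G (stabilization G c)" using *(1) assms by (rule topples_nonneg)
  show "c - stabilization G c \<in> L" using topples_congruent[OF *(1) c] by simp
qed

lemma finite_stable_nonneg: "finite {c. nonneg_config G c \<and> stable_config G c}"
proof (rule finite_subset)
  let ?F = "PiE V (\<lambda>v. {0..<int (outdeg G v)})"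
  show "{c. nonneg_config G c \<and> stable_config G c} \<subseteq> config_of ` ?F"
  proof
    fix c assume c: "c \<in> {c. nonneg_config G c \<and> stable_config G c}"
    then have "c = config_of (restrict (amount c) V)"
      by (intro config_eqI) (auto simp: nonneg_config_iff)
    moreover have "restrict (amount c) V \<in> ?F"
      using c by (auto simp: nonneg_config_iff stable_config_iff)
    ultimately show "c \<in> config_of ` ?F" by blast
  qed
  show "finite (config_of ` ?F)" by (intro finite_imageI finite_PiE) auto
qed

text \<open>There are finitely many stable nonnegative configurations, so two multiples of a grain have the same
  stabilization, and their difference lies in the lattice.\<close>

lemma grain_torsion:
  assumes v: "v \<in> V"
  obtains m :: int where "m > 0" "frag_cmul m (frag_of v) \<in> L"
proof -
  let ?g = "\<lambda>k::nat. frag_cmul (int k) (frag_of v)"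
  have nn: "nonneg_config G (?g k)" for k using v by (simp add: nonneg_config_iff)
  have "range (\<lambda>k. stabilization G (?g k)) \<subseteq> {c. nonneg_config G c \<and> stable_config G c}"
    using stabilization[OF nn] by auto
  then have "\<not> inj (\<lambda>k. stabilization G (?g k))"
    using finite_subset[OF _ finite_stable_nonneg] range_inj_infinite by blast
  then obtain i j where ij: "stabilization G (?g i) = stabilization G (?g j)" "i < j"
    unfolding inj_def by (metis linorder_neqE_nat)
  have "?g j - stabilization G (?g i) \<in> L" unfolding ij(1) by (rule stabilization(4)[OF nn])
  then have "?g j - ?g i \<in> L" by (rule lattice_trans) (rule lattice_commute[OF stabilization(4)[OF nn]])
  also have "?g j - ?g i = frag_cmul (int j - int i) (frag_of v)" by (simp add: frag_cmul_diff_distrib)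
  finally show ?thesis using that[of "int j - int i"] ij(2) by simp
qed

text \<open>Positive multiples of single grains lie in the lattice, so it is unbounded above in all coordinates
  at once. Every class is therefore represented by arbitrarily large configurations.\<close>

lemma ex_lattice_above:
  obtains x where "x \<in> L" "\<And>v. v \<in> V \<Longrightarrow> amount x v \<ge> f v"
proof -
  have "\<exists>m. \<forall>v\<in>V. m v > 0 \<and> frag_cmul (m v) (frag_of v) \<in> L"
    by (intro bchoice) (metis grain_torsion)
  then obtain m where m: "\<And>v. v \<in> V \<Longrightarrow> m v > 0" "\<And>v. v \<in> V \<Longrightarrow> frag_cmul (m v) (frag_of v) \<in> L"
    by blast
  define x where "x = config_of (\<lambda>v. \<bar>f v\<bar> * m v)"
  have "x = (\<Sum>v\<in>V. frag_cmul \<bar>f v\<bar> (frag_cmul (m v) (frag_of v)))" by (simp add: x_def config_of_def)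
  also have "\<dots> \<in> L" by (intro lattice_sum lattice_cmul[OF m(2)])
  finally have "x \<in> L" .
  moreover have "amount x v \<ge> f v" if v: "v \<in> V" for v
  proof -
    have "f v \<le> \<bar>f v\<bar> * 1" by simp
    also have "\<dots> \<le> \<bar>f v\<bar> * m v" using m(1)[OF v] by (intro mult_left_mono) auto
    finally show ?thesis using v by (simp add: x_def)
  qed
  ultimately show ?thesis using that by blast
qed

lemma ex_nonneg_congruent:
  assumes "c \<in> configs"
  obtains d where "nonneg_config G d" "c - d \<in> L"
proof -
  obtain x where x: "x \<in> L" "\<And>v. v \<in> V \<Longrightarrow> amount x v \<ge> - amount c v"
    using ex_lattice_above[of "\<lambda>v. - amount c v"] by blast
  have "nonneg_config G (c + x)" using assms x lattice_config by (force simp: nonneg_config_iff lookup_add)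
  then show ?thesis using that[of "c + x"] lattice_minus[OF x(1)] by simp
qed

lemma ex_superstable_congruent:
  assumes "c \<in> configs"
  obtains s where "s \<in> superstable_configs G" "c - s \<in> L"
proof -
  obtain d where d: "nonneg_config G d" "c - d \<in> L" using ex_nonneg_congruent[OF assms] .
  obtain s where "s \<in> superstable_configs G" "d - s \<in> L" using ex_superstable_below[OF d(1)] .
  then show ?thesis using that lattice_trans[OF d(2)] by blast
qed

section \<open>Recurrent configurations\<close>

abbreviation c_max where "c_max \<equiv> max_stable_config G"

lemma c_max_config [simp]: "c_max \<in> configs"
  and amount_c_max [simp]: "v \<in> V \<Longrightarrow> amount c_max v = int (outdeg G v) - 1"
  using config_of_config[of "\<lambda>v. int (outdeg G v) - 1"] amount_config_of[of v "\<lambda>v. int (outdeg G v) - 1"]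
  by (simp_all add: max_stable_config_def config_of_def)

lemma c_max_nonneg: "nonneg_config G c_max"
  using outdeg_pos by (force simp: nonneg_config_iff)

lemma stable_iff_le_c_max: "c \<in> configs \<Longrightarrow> stable_config G c \<longleftrightarrow> nonneg_config G (c_max - c)"
  by (auto simp: stable_config_iff nonneg_config_iff lookup_minus)

text \<open>To stabilize, a configuration with at least \<open>outdeg v * \<sigma> v\<close> grains more than \<open>c_max\<close> at each \<open>v\<close> has
  to fire each \<open>v\<close> at least \<open>\<sigma> v\<close> times. If \<open>c_max - c - \<Delta> \<sigma>\<close> is nonnegative, then \<open>c + \<Delta> \<sigma>\<close> is stable, so
  these firings could be left out; the least action principle excludes this unless \<open>\<sigma> = 0\<close>.\<close>

lemma no_firing_of_complement:
  assumes e: "e \<in> configs" "\<And>v. v \<in> V \<Longrightarrow> amount e v \<ge> amount c_max v + int (outdeg G v) * amount \<sigma> v"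
    and topples: "topples_to G e c" and c: "stable_config G c"
    and \<sigma>: "nonneg_config G \<sigma>" and nn: "nonneg_config G (c_max - c - \<Delta> \<sigma>)"
  shows "\<sigma> = 0"
proof -
  obtain \<tau> where \<tau>: "nonneg_config G \<tau>" "c = e - \<Delta> \<tau>"
    and least: "\<And>\<rho> v. nonneg_config G \<rho> \<Longrightarrow> stable_config G (e - \<Delta> \<rho>) \<Longrightarrow> v \<in> V \<Longrightarrow> amount \<tau> v \<le> amount \<rho> v"
    using topples_script[OF topples e(1)] by metis
  have \<sigma>\<tau>: "amount \<sigma> v \<le> amount \<tau> v" if v: "v \<in> V" for v
  proof -
    have "amount e v - amount (\<Delta> \<tau>) v \<le> int (outdeg G v) - 1"
      using c v by (force simp: \<tau>(2) stable_config_iff lookup_minus)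
    then have "int (outdeg G v) * amount \<sigma> v \<le> int (outdeg G v) * amount \<tau> v"
      using e(2)[OF v] amount_laplacian_le[OF \<tau>(1) v] v by (simp add: mult.commute)
    then show ?thesis using outdeg_pos[OF v] by simp
  qed
  have cc: "\<sigma> \<in> configs" "\<tau> \<in> configs" "c \<in> configs"
    using \<sigma> \<tau> c by (auto simp: nonneg_config_iff stable_config_iff)
  have "nonneg_config G (\<tau> - \<sigma>)" using \<sigma>\<tau> cc by (simp add: nonneg_config_iff lookup_minus)
  moreover have "e - \<Delta> (\<tau> - \<sigma>) = c + \<Delta> \<sigma>" by (simp add: laplacian_diff \<tau>(2))
  moreover have "stable_config G (c + \<Delta> \<sigma>)"
    using nn cc by (subst stable_iff_le_c_max) (simp_all add: diff_diff_eq)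
  ultimately have "amount \<tau> v \<le> amount (\<tau> - \<sigma>) v" if "v \<in> V" for v using least that by metis
  then show ?thesis
    using \<sigma> cc(1) by (intro config_eqI) (force simp: lookup_minus nonneg_config_iff)+
qed

lemma superstable_le_c_max:
  assumes "s \<in> superstable_configs G" "v \<in> V"
  shows "amount s v \<le> amount c_max v"
proof (rule ccontr)
  assume "\<not> ?thesis"
  then have v: "amount s v \<ge> int (outdeg G v)" using assms(2) by simp
  have s: "nonneg_config G s" using assms(1) by (simp add: superstable_iff)
  have "legal_firing G s (s - \<Delta> (frag_of v))" using v assms(2) by (auto simp: legal_firing_def)
  then have "nonneg_config G (s - \<Delta> (frag_of v))" using s by (rule legal_firing_nonneg)
  then show False using assms frag_of_nonneg frag_of_nonzero by (metis superstable_iff)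
qed

text \<open>A recurrent configuration is reached from configurations as large as one likes, so
  \<open>no_firing_of_complement\<close> applies to every \<open>\<sigma>\<close>. Conversely, let \<open>c_max - c\<close> be superstable. Every
  configuration lies below one in the class of \<open>c\<close> that is large enough for all \<open>\<sigma>\<close> that matter; the complement of its stabilization is superstable as well, and as superstable
  representatives are unique, the stabilization is \<open>c\<close>.\<close>

lemma recurrent_iff_superstable:
  assumes c: "c \<in> configs"
  shows "c \<in> recurrent_configs G \<longleftrightarrow> c_max - c \<in> superstable_configs G"
proof
  assume "c \<in> recurrent_configs G"
  then have nn: "nonneg_config G c" and st: "stable_config G c"
    and rec: "\<And>a. a \<in> configs \<Longrightarrow> \<exists>b. nonneg_config G b \<and> topples_to G (a + b) c"
    by (auto simp: recurrent_configs_def)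
  have "\<sigma> = 0" if \<sigma>: "nonneg_config G \<sigma>" "nonneg_config G (c_max - c - \<Delta> \<sigma>)" for \<sigma>
  proof -
    define a where "a = config_of (\<lambda>v. amount c_max v + int (outdeg G v) * amount \<sigma> v)"
    obtain b where b: "nonneg_config G b" "topples_to G (a + b) c"
      using rec[of a] by (auto simp: a_def)
    show ?thesis
      using _ _ b(2) st \<sigma> by (rule no_firing_of_complement) (use b(1) in \<open>auto simp: a_def nonneg_config_iff lookup_add\<close>)
  qed
  then show "c_max - c \<in> superstable_configs G"
    using st c by (auto simp: superstable_iff stable_iff_le_c_max)
next
  assume ss: "c_max - c \<in> superstable_configs G"
  have st: "stable_config G c" using ss c by (simp add: superstable_iff stable_iff_le_c_max)
  have nn: "nonneg_config G c"
    using superstable_le_c_max[OF ss] c by (force simp: nonneg_config_iff lookup_minus)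
  \<comment> \<open>The potential of \<open>c_max\<close> bounds the entries of every \<open>\<sigma>\<close> with \<open>c_max - d - \<Delta> \<sigma>\<close> and \<open>d\<close> nonnegative.\<close>
  define K where "K = potential c_max"
  define big where "big v = amount c_max v + int (outdeg G v) * K" for v
  have K: "K \<ge> 0" unfolding K_def by (rule potential_nonneg[OF c_max_nonneg])
  have big: "big v \<ge> 0" if "v \<in> V" for v
    using c_max_nonneg K that by (simp add: big_def nonneg_config_iff)
  have "\<exists>b. nonneg_config G b \<and> topples_to G (a + b) c" if a: "a \<in> configs" for a
  proof -
    obtain x where x: "x \<in> L" "\<And>v. v \<in> V \<Longrightarrow> amount x v \<ge> max (big v - amount c v) (amount a v - amount c v)"
      using ex_lattice_above[of "\<lambda>v. max (big v - amount c v) (amount a v - amount c v)"] by blast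
    define e where "e = c + x"
    have e: "e \<in> configs" using c x lattice_config by (simp add: e_def)
    have e_big: "amount e v \<ge> big v" "amount e v \<ge> amount a v" if "v \<in> V" for v
      using x(2)[OF that] by (auto simp: e_def lookup_add)
    have enn: "nonneg_config G e" using e e_big(1) big by (force simp: nonneg_config_iff)
    let ?d = "stabilization G e"
    note d = stabilization[OF enn]
    have dc: "?d \<in> configs" using d(2) by (simp add: stable_config_iff)
    have "c_max - ?d \<in> superstable_configs G"
      unfolding superstable_iff
    proof (intro conjI allI impI)
      show "nonneg_config G (c_max - ?d)" using d(2) dc stable_iff_le_c_max by simp
      fix \<sigma> assume \<sigma>: "nonneg_config G \<sigma>" "nonneg_config G (c_max - ?d - \<Delta> \<sigma>)"
      have "amount \<sigma> v \<le> K" if v: "v \<in> V" for v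
        using potential_laplacian[OF \<sigma>(1) v] potential_nonneg[OF \<sigma>(2)] potential_nonneg[OF d(3)]
        by (simp add: potential_diff K_def)
      then have "int (outdeg G v) * amount \<sigma> v \<le> int (outdeg G v) * K" if "v \<in> V" for v
        using that by (intro mult_left_mono) auto
      then have "amount e v \<ge> amount c_max v + int (outdeg G v) * amount \<sigma> v" if "v \<in> V" for v
        using e_big(1)[OF that] that by (force simp: big_def)
      with e show "\<sigma> = 0" using d(1,2) \<sigma> by (rule no_firing_of_complement)
    qed
    moreover have "(c_max - c) - (c_max - ?d) \<in> L"
    proof -
      have "(c_max - c) - (c_max - ?d) = x - (e - ?d)" by (simp add: e_def)
      then show ?thesis using lattice_diff[OF x(1) d(4)] by (simp only:)
    qed
    ultimately have "c_max - c = c_max - ?d" using ss superstable_unique by blast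
    then have "?d = c" by simp
    moreover have "nonneg_config G (e - a)" using e a e_big(2) by (simp add: nonneg_config_iff lookup_minus)
    ultimately show ?thesis using d(1) by (intro exI[of _ "e - a"]) simp
  qed
  then show "c \<in> recurrent_configs G" using nn st by (simp add: recurrent_configs_def)
qed

lemma recurrent_config: "c \<in> recurrent_configs G \<Longrightarrow> c \<in> configs"
  and recurrent_nonneg: "c \<in> recurrent_configs G \<Longrightarrow> nonneg_config G c"
  by (auto simp: recurrent_configs_def nonneg_config_iff)

lemma superstable_config: "c \<in> superstable_configs G \<Longrightarrow> c \<in> configs"
  by (auto simp: superstable_iff nonneg_config_iff)

lemma ex_recurrent_congruent:
  assumes "c \<in> configs"
  obtains r where "r \<in> recurrent_configs G" "c - r \<in> L"
proof -
  obtain s where s: "s \<in> superstable_configs G" "c_max - c - s \<in> L"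
    using ex_superstable_congruent[of "c_max - c"] assms by auto
  have "c_max - s \<in> recurrent_configs G"
    using s(1) superstable_config[OF s(1)] by (simp add: recurrent_iff_superstable)
  moreover have "c - (c_max - s) \<in> L" using lattice_minus[OF s(2)] by (simp add: algebra_simps)
  ultimately show ?thesis by (rule that)
qed

lemma recurrent_unique:
  assumes "c \<in> recurrent_configs G" "d \<in> recurrent_configs G" "c - d \<in> L"
  shows "c = d"
proof -
  have "(c_max - c) - (c_max - d) \<in> L" using lattice_minus[OF assms(3)] by simp
  then have "c_max - c = c_max - d"
    using assms recurrent_config by (intro superstable_unique) (simp_all flip: recurrent_iff_superstable)
  then show ?thesis by simp
qed

lemma stabilization_recurrent:
  assumes a: "a \<in> recurrent_configs G" and b: "nonneg_config G b"
  shows "stabilization G (a + b) \<in> recurrent_configs G"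
proof -
  have ab: "nonneg_config G (a + b)" using recurrent_nonneg[OF a] b by (rule nonneg_add)
  have "\<exists>y. nonneg_config G y \<and> topples_to G (x + y) (stabilization G (a + b))" if x: "x \<in> configs" for x
  proof -
    obtain y where y: "nonneg_config G y" "topples_to G (x + y) a"
      using a x by (auto simp: recurrent_configs_def)
    have "topples_to G (x + (y + b)) (stabilization G (a + b))"
      using topples_trans[OF topples_add[OF y(2) b] stabilization(1)[OF ab]] by (simp add: add.assoc)
    then show ?thesis using nonneg_add[OF y(1) b] by blast
  qed
  then show ?thesis using stabilization[OF ab] by (simp add: recurrent_configs_def)
qed

end

context sandpile
begin

section \<open>The sandpile group as the group of classes\<close>

sublocale configs: comm_group "config_group G"
  by (rule abelian_free_Abelian_group)

lemma subgroup_lattice: "subgroup L (config_group G)"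
proof (rule configs.subgroupI)
  show "L \<noteq> {}" using lattice_0 by blast
qed (use lattice_config lattice_add lattice_minus in \<open>auto simp: in_configs_iff\<close>)

sublocale lattice: normal L "config_group G"
  by (rule configs.subgroup_imp_normal[OF subgroup_lattice])

lemma lattice_absorb: "x \<in> L \<Longrightarrow> a - (x + c) \<in> L \<Longrightarrow> a - c \<in> L"
  using lattice_trans[of a "x + c" c] by simp

lemma mem_config_class_iff: "d \<in> config_class G c \<longleftrightarrow> d - c \<in> L"
  by (auto simp: config_class_def r_coset_def intro!: bexI[of _ "d - c"])

lemma config_class_eq_iff: "config_class G c = config_class G d \<longleftrightarrow> c - d \<in> L"
proof
  assume "config_class G c = config_class G d"
  then show "c - d \<in> L" by (metis mem_config_class_iff cancel_comm_monoid_add_class.diff_cancel lattice_0)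
next
  assume "c - d \<in> L"
  then show "config_class G c = config_class G d"
    using lattice_trans[of _ c d] lattice_trans[OF _ lattice_commute, of _ d c]
    by (auto simp: mem_config_class_iff)
qed

lemma carrier_class_group: "carrier (config_class_group G) = config_class G ` configs"
  by (auto simp: config_class_group_def FactGroup_def RCOSETS_def config_class_def)

lemma class_group_mult:
  "c \<in> configs \<Longrightarrow> d \<in> configs \<Longrightarrow>
     config_class G c \<otimes>\<^bsub>config_class_group G\<^esub> config_class G d = config_class G (c + d)"
  using lattice.rcos_sum[of c d] by (simp add: config_class_group_def FactGroup_def config_class_def)

lemma comm_group_class_group: "comm_group (config_class_group G)"
  unfolding config_class_group_def by (rule configs.abelian_FactGroup[OF subgroup_lattice])

lemma bij_recurrent: "bij_betw (config_class G) (recurrent_configs G) (carrier (config_class_group G))"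
  unfolding bij_betw_def
proof
  show "inj_on (config_class G) (recurrent_configs G)"
    using recurrent_unique by (auto simp: inj_on_def config_class_eq_iff)
  show "config_class G ` recurrent_configs G = carrier (config_class_group G)"
    unfolding carrier_class_group using recurrent_config
    by (auto simp: image_iff config_class_eq_iff) (metis ex_recurrent_congruent)
qed

lemma bij_superstable: "bij_betw (config_class G) (superstable_configs G) (carrier (config_class_group G))"
  unfolding bij_betw_def
proof
  show "inj_on (config_class G) (superstable_configs G)"
    using superstable_unique by (auto simp: inj_on_def config_class_eq_iff)
  show "config_class G ` superstable_configs G = carrier (config_class_group G)"
    unfolding carrier_class_group using superstable_config
    by (auto simp: image_iff config_class_eq_iff) (metis ex_superstable_congruent)
qed

lemma finite_recurrent: "finite (recurrent_configs G)"
  by (rule finite_subset[OF _ finite_stable_nonneg]) (auto simp: recurrent_configs_def)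

lemma carrier_sandpile_group [simp]: "carrier (sandpile_group G) = recurrent_configs G"
  by (simp add: sandpile_group_def)

lemma sandpile_group_mult:
  "a \<otimes>\<^bsub>sandpile_group G\<^esub> b = stabilization G (a + b)"
  by (simp add: sandpile_group_def)

lemma config_class_mult:
  assumes "a \<in> recurrent_configs G" "b \<in> recurrent_configs G"
  shows "a \<otimes>\<^bsub>sandpile_group G\<^esub> b \<in> recurrent_configs G"
    and "config_class G (a \<otimes>\<^bsub>sandpile_group G\<^esub> b) = config_class G (a + b)"
  using assms stabilization_recurrent[OF assms(1) recurrent_nonneg[OF assms(2)]]
    lattice_commute[OF stabilization(4)[OF nonneg_add[OF recurrent_nonneg[OF assms(1)] recurrent_nonneg[OF assms(2)]]]]
  by (simp_all add: sandpile_group_mult config_class_eq_iff)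

lemma recurrent_eqI:
  "a \<in> recurrent_configs G \<Longrightarrow> b \<in> recurrent_configs G \<Longrightarrow> config_class G a = config_class G b \<Longrightarrow> a = b"
  by (simp add: config_class_eq_iff recurrent_unique)

text \<open>The recurrent configuration in the class of 0 is neutral, and it is the only neutral element because
  the addition is commutative.\<close>

lemma sandpile_group_one:
  shows "\<one>\<^bsub>sandpile_group G\<^esub> \<in> recurrent_configs G"
    and "config_class G \<one>\<^bsub>sandpile_group G\<^esub> = config_class G 0"
proof -
  obtain e where e: "e \<in> recurrent_configs G" "0 - e \<in> L" using ex_recurrent_congruent[of 0] by auto
  have neutral: "stabilization G (e + c) = c" if c: "c \<in> recurrent_configs G" for c
  proof (rule recurrent_eqI)
    show "stabilization G (e + c) \<in> recurrent_configs G"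
      using config_class_mult(1)[OF e(1) c] by (simp add: sandpile_group_mult)
    show "config_class G (stabilization G (e + c)) = config_class G c"
      using config_class_mult(2)[OF e(1) c] lattice_commute[OF e(2)]
      by (simp add: sandpile_group_mult config_class_eq_iff lattice_absorb)
  qed fact
  have "(THE e. e \<in> recurrent_configs G \<and> (\<forall>c\<in>recurrent_configs G. stabilization G (e + c) = c)) = e"
  proof (rule the_equality)
    show "e \<in> recurrent_configs G \<and> (\<forall>c\<in>recurrent_configs G. stabilization G (e + c) = c)"
      using e neutral by simp
    fix e' assume e': "e' \<in> recurrent_configs G \<and> (\<forall>c\<in>recurrent_configs G. stabilization G (e' + c) = c)"
    then have "stabilization G (e' + e) = e" using e by blast
    moreover have "stabilization G (e + e') = e'" using neutral e' by blast
    ultimately show "e' = e" by (simp add: add.commute)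
  qed
  then have "\<one>\<^bsub>sandpile_group G\<^esub> = e" by (simp add: sandpile_group_def)
  then show "\<one>\<^bsub>sandpile_group G\<^esub> \<in> recurrent_configs G"
    "config_class G \<one>\<^bsub>sandpile_group G\<^esub> = config_class G 0"
    using e lattice_commute[OF e(2)] by (simp_all add: config_class_eq_iff)
qed

sublocale sandpile_group: finite_comm_group "sandpile_group G"
proof -
  have "comm_group (sandpile_group G)"
  proof (rule comm_groupI)
    fix x y z assume "x \<in> carrier (sandpile_group G)" "y \<in> carrier (sandpile_group G)" "z \<in> carrier (sandpile_group G)"
    then have xyz: "x \<in> recurrent_configs G" "y \<in> recurrent_configs G" "z \<in> recurrent_configs G" by auto
    have cls: "config_class G (a \<otimes>\<^bsub>sandpile_group G\<^esub> b) = config_class G a \<otimes>\<^bsub>config_class_group G\<^esub> config_class G b"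
      if "a \<in> recurrent_configs G" "b \<in> recurrent_configs G" for a b
      using config_class_mult[OF that] that recurrent_config by (simp add: class_group_mult)
    interpret M: comm_group "config_class_group G" by (rule comm_group_class_group)
    have in_M: "config_class G a \<in> carrier (config_class_group G)" if "a \<in> recurrent_configs G" for a
      using that recurrent_config by (auto simp: carrier_class_group)
    show "(x \<otimes>\<^bsub>sandpile_group G\<^esub> y) \<otimes>\<^bsub>sandpile_group G\<^esub> z = x \<otimes>\<^bsub>sandpile_group G\<^esub> (y \<otimes>\<^bsub>sandpile_group G\<^esub> z)"
      using xyz by (intro recurrent_eqI config_class_mult) (simp_all add: cls config_class_mult in_M M.m_assoc)
  next
    fix x y assume "x \<in> carrier (sandpile_group G)" "y \<in> carrier (sandpile_group G)"
    then show "x \<otimes>\<^bsub>sandpile_group G\<^esub> y \<in> carrier (sandpile_group G)" by (simp add: config_class_mult)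
    show "x \<otimes>\<^bsub>sandpile_group G\<^esub> y = y \<otimes>\<^bsub>sandpile_group G\<^esub> x" by (simp add: sandpile_group_mult add.commute)
  next
    show "\<one>\<^bsub>sandpile_group G\<^esub> \<in> carrier (sandpile_group G)" by (simp add: sandpile_group_one)
  next
    fix x assume "x \<in> carrier (sandpile_group G)"
    then have x: "x \<in> recurrent_configs G" by simp
    note one = sandpile_group_one
    show "\<one>\<^bsub>sandpile_group G\<^esub> \<otimes>\<^bsub>sandpile_group G\<^esub> x = x"
      using x one config_class_mult[OF one(1) x] by (intro recurrent_eqI) (auto simp: config_class_eq_iff intro: lattice_absorb)
    obtain y where y: "y \<in> recurrent_configs G" "- x - y \<in> L"
      using ex_recurrent_congruent[of "- x"] recurrent_config[OF x] by auto
    have "y \<otimes>\<^bsub>sandpile_group G\<^esub> x = \<one>\<^bsub>sandpile_group G\<^esub>"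
    proof (rule recurrent_eqI)
      have "y \<otimes>\<^bsub>sandpile_group G\<^esub> x - 0 \<in> L"
        using config_class_mult[OF y(1) x] lattice_minus[OF y(2)]
        by - (rule lattice_absorb[of "y + x"], simp_all add: config_class_eq_iff)
      then show "config_class G (y \<otimes>\<^bsub>sandpile_group G\<^esub> x) = config_class G \<one>\<^bsub>sandpile_group G\<^esub>"
        unfolding one(2) config_class_eq_iff .
    qed (use one config_class_mult[OF y(1) x] in auto)
    then show "\<exists>y\<in>carrier (sandpile_group G). y \<otimes>\<^bsub>sandpile_group G\<^esub> x = \<one>\<^bsub>sandpile_group G\<^esub>"
      using y(1) by auto
  qed
  then show "finite_comm_group (sandpile_group G)"
    using finite_recurrent by (simp add: finite_comm_group_def finite_comm_group_axioms_def)
qed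

text \<open>The inverse of the identification of the sandpile group with the group of classes, composed with the
  projection of configurations to their classes.\<close>

definition recurrent_rep :: "('v \<Rightarrow>\<^sub>0 int) \<Rightarrow> ('v \<Rightarrow>\<^sub>0 int)" where
  "recurrent_rep c = the_inv_into (recurrent_configs G) (config_class G) (config_class G c)"

lemma grain_elem_eq: "grain_elem G v = recurrent_rep (frag_of v)"
  by (simp add: grain_elem_def recurrent_rep_def)

lemma recurrent_rep:
  assumes "c \<in> configs"
  shows "recurrent_rep c \<in> recurrent_configs G" "config_class G (recurrent_rep c) = config_class G c"
proof -
  have "config_class G c \<in> config_class G ` recurrent_configs G"
    using bij_recurrent assms by (auto simp: bij_betw_def carrier_class_group)
  then show "recurrent_rep c \<in> recurrent_configs G" "config_class G (recurrent_rep c) = config_class G c"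
    unfolding recurrent_rep_def using bij_recurrent
    by (simp_all add: bij_betw_def the_inv_into_into f_the_inv_into_f)
qed

lemma recurrent_rep_eqI: "c \<in> configs \<Longrightarrow> r \<in> recurrent_configs G \<Longrightarrow> c - r \<in> L \<Longrightarrow> recurrent_rep c = r"
  using recurrent_rep[of c] config_class_eq_iff[of c r] by (intro recurrent_eqI) simp_all

lemma recurrent_rep_self: "r \<in> recurrent_configs G \<Longrightarrow> recurrent_rep r = r"
  by (rule recurrent_rep_eqI) (simp_all add: recurrent_config)

lemma recurrent_rep_eq_iff:
  "c \<in> configs \<Longrightarrow> d \<in> configs \<Longrightarrow> recurrent_rep c = recurrent_rep d \<longleftrightarrow> c - d \<in> L"
  using recurrent_rep[of c] recurrent_rep[of d] recurrent_eqI[of "recurrent_rep c" "recurrent_rep d"]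
    config_class_eq_iff[of c d] by auto

lemma recurrent_rep_add:
  assumes "c \<in> configs" "d \<in> configs"
  shows "recurrent_rep (c + d) = recurrent_rep c \<otimes>\<^bsub>sandpile_group G\<^esub> recurrent_rep d"
proof (rule recurrent_eqI)
  note rr = recurrent_rep[OF assms(1)] recurrent_rep[OF assms(2)]
  show "config_class G (recurrent_rep (c + d)) = config_class G (recurrent_rep c \<otimes>\<^bsub>sandpile_group G\<^esub> recurrent_rep d)"
    using rr recurrent_rep[of "c + d"] assms config_class_mult[OF rr(1,3)] recurrent_config
    by (simp flip: class_group_mult)
qed (use assms recurrent_rep config_class_mult in auto)

end

section \<open>Monomials and their classes\<close>

text \<open>The linear functional on polynomials that takes the value \<open>f m\<close> at the monomial with exponent \<open>m\<close>.
  Both evaluation at a point and the class sums have this form.\<close>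

definition coeff_sum :: "(('v \<Rightarrow>\<^sub>0 nat) \<Rightarrow> complex) \<Rightarrow> 'v cpoly \<Rightarrow> complex" where
  "coeff_sum f p = (\<Sum>m\<in>Poly_Mapping.keys p. Poly_Mapping.lookup p m * f m)"

lemma coeff_sum_superset:
  "finite S \<Longrightarrow> Poly_Mapping.keys p \<subseteq> S \<Longrightarrow> coeff_sum f p = (\<Sum>m\<in>S. Poly_Mapping.lookup p m * f m)"
  unfolding coeff_sum_def by (rule sum.mono_neutral_left) (auto simp: in_keys_iff)

lemma keys_poly_scale: "Poly_Mapping.keys (poly_scale a p) \<subseteq> Poly_Mapping.keys p"
  by (auto simp: in_keys_iff)

lemma coeff_sum_add: "coeff_sum f (p + q) = coeff_sum f p + coeff_sum f q"
proof -
  let ?S = "Poly_Mapping.keys p \<union> Poly_Mapping.keys q"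
  show ?thesis
    using Poly_Mapping.keys_add[of p q]
    by (simp add: coeff_sum_superset[of ?S] lookup_add distrib_right sum.distrib)
qed

lemma coeff_sum_scale: "coeff_sum f (poly_scale a p) = a * coeff_sum f p"
  using keys_poly_scale[of a p]
  by (simp add: coeff_sum_superset[of "Poly_Mapping.keys p"] sum_distrib_left mult.assoc)

lemma coeff_sum_0 [simp]: "coeff_sum f 0 = 0"
  by (simp add: coeff_sum_def)

lemma coeff_sum_diff: "coeff_sum f (p - q) = coeff_sum f p - coeff_sum f q"
  using coeff_sum_add[of f "p - q" q] by simp

lemma coeff_sum_single [simp]: "coeff_sum f (Poly_Mapping.single m 1) = f m"
  by (simp add: coeff_sum_def)

lemma cpoly_expand:
  "p = (\<Sum>m\<in>Poly_Mapping.keys p. poly_scale (Poly_Mapping.lookup p m) (Poly_Mapping.single m 1))"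
proof (rule poly_mapping_eqI)
  fix k
  have "Poly_Mapping.lookup (\<Sum>m\<in>Poly_Mapping.keys p. poly_scale (Poly_Mapping.lookup p m) (Poly_Mapping.single m 1)) k
    = (\<Sum>m\<in>Poly_Mapping.keys p. if m = k then Poly_Mapping.lookup p k else 0)"
    unfolding lookup_sum lookup_poly_scale lookup_single by (intro sum.cong) (auto simp: when_def)
  then show "Poly_Mapping.lookup p k = Poly_Mapping.lookup (\<Sum>m\<in>Poly_Mapping.keys p. poly_scale (Poly_Mapping.lookup p m) (Poly_Mapping.single m 1)) k"
    by (simp add: in_keys_iff)
qed

lemma exponents_0 [simp]: "0 \<in> exponents G"
  and exponents_add [simp]: "u \<in> exponents G \<Longrightarrow> w \<in> exponents G \<Longrightarrow> u + w \<in> exponents G"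
  and exponents_single [simp]: "v \<in> nonsink G \<Longrightarrow> Poly_Mapping.single v k \<in> exponents G"
  using Poly_Mapping.keys_add[of u w] by (auto simp: exponents_def)

lemma nonsink_polys_single [simp]: "m \<in> exponents G \<Longrightarrow> Poly_Mapping.single m 1 \<in> nonsink_polys G"
  by (simp add: nonsink_polys_def)

lemma subspace_nonsink_polys: "cpoly.subspace (nonsink_polys G)"
  unfolding nonsink_polys_def
  by (rule cpoly.subspaceI) (use Poly_Mapping.keys_add keys_poly_scale in \<open>force+\<close>)

lemma subspace_polys_le: "cpoly.subspace (polys_le G d)"
  unfolding polys_le_def
proof (rule cpoly.subspaceI)
  show "0 \<in> {p \<in> nonsink_polys G. \<forall>m\<in>Poly_Mapping.keys p. exponent_deg m \<le> d}"
    using cpoly.subspace_0[OF subspace_nonsink_polys] by simp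
next
  fix p q
  assume "p \<in> {p \<in> nonsink_polys G. \<forall>m\<in>Poly_Mapping.keys p. exponent_deg m \<le> d}"
    "q \<in> {p \<in> nonsink_polys G. \<forall>m\<in>Poly_Mapping.keys p. exponent_deg m \<le> d}"
  then show "p + q \<in> {p \<in> nonsink_polys G. \<forall>m\<in>Poly_Mapping.keys p. exponent_deg m \<le> d}"
    using cpoly.subspace_add[OF subspace_nonsink_polys, of p G q] Poly_Mapping.keys_add[of p q] by auto
next
  fix a p
  assume "p \<in> {p \<in> nonsink_polys G. \<forall>m\<in>Poly_Mapping.keys p. exponent_deg m \<le> d}"
  then show "poly_scale a p \<in> {p \<in> nonsink_polys G. \<forall>m\<in>Poly_Mapping.keys p. exponent_deg m \<le> d}"
    using cpoly.subspace_scale[OF subspace_nonsink_polys, of p G a] keys_poly_scale[of a p] by auto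
qed

context sandpile
begin

definition config_of_exponent :: "('v \<Rightarrow>\<^sub>0 nat) \<Rightarrow> ('v \<Rightarrow>\<^sub>0 int)" where
  "config_of_exponent u = Poly_Mapping.map int u"

lemma amount_config_of_exponent [simp]: "amount (config_of_exponent u) v = int (Poly_Mapping.lookup u v)"
  by (simp add: config_of_exponent_def map.rep_eq when_def)

lemma config_of_exponent_config [simp]: "u \<in> exponents G \<Longrightarrow> config_of_exponent u \<in> configs"
  by (auto simp: in_configs_iff exponents_def in_keys_iff subset_iff)

lemma config_of_exponent_add: "config_of_exponent (u + w) = config_of_exponent u + config_of_exponent w"
  by (rule poly_mapping_eqI) (simp add: lookup_add)

lemma config_of_exponent_0: "config_of_exponent 0 = 0"
  by (rule poly_mapping_eqI) simp

lemma config_of_exponent_single: "config_of_exponent (Poly_Mapping.single v 1) = frag_of v"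
  by (rule poly_mapping_eqI) (simp add: lookup_single when_def)

lemma ex_exponent:
  assumes "nonneg_config G c"
  obtains u where "u \<in> exponents G" "config_of_exponent u = c"
proof
  let ?u = "Poly_Mapping.map nat c"
  have l: "Poly_Mapping.lookup ?u v = nat (amount c v)" for v by (simp add: map.rep_eq when_def)
  show u: "?u \<in> exponents G"
    using assms by (auto simp: exponents_def nonneg_config_iff in_configs_iff subset_iff in_keys_iff l)
  show "config_of_exponent ?u = c"
    using u assms by (intro config_eqI) (auto simp: nonneg_config_iff l)
qed

lemma config_of_exponent_nonneg: "u \<in> exponents G \<Longrightarrow> nonneg_config G (config_of_exponent u)"
  by (simp add: nonneg_config_iff)

lemma config_deg_exponent:
  assumes "u \<in> exponents G"
  shows "config_deg G (config_of_exponent u) = int (exponent_deg u)"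
proof -
  have "exponent_deg u = (\<Sum>v\<in>V. Poly_Mapping.lookup u v)"
    unfolding exponent_deg_def using assms
    by (intro sum.mono_neutral_left) (auto simp: exponents_def in_keys_iff)
  then show ?thesis by (simp add: config_deg_def)
qed

abbreviation S where "S \<equiv> sandpile_group G"

definition sandpile_class :: "('v \<Rightarrow>\<^sub>0 nat) \<Rightarrow> ('v \<Rightarrow>\<^sub>0 int)" where
  "sandpile_class u = recurrent_rep (config_of_exponent u)"

lemma sandpile_class_recurrent [simp]: "u \<in> exponents G \<Longrightarrow> sandpile_class u \<in> recurrent_configs G"
  by (simp add: sandpile_class_def recurrent_rep)

lemma sandpile_class_eq_iff:
  "u \<in> exponents G \<Longrightarrow> w \<in> exponents G \<Longrightarrow>
     sandpile_class u = sandpile_class w \<longleftrightarrow> config_of_exponent u - config_of_exponent w \<in> L"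
  by (simp add: sandpile_class_def recurrent_rep_eq_iff)

lemma sandpile_class_add:
  "u \<in> exponents G \<Longrightarrow> w \<in> exponents G \<Longrightarrow>
     sandpile_class (u + w) = sandpile_class u \<otimes>\<^bsub>S\<^esub> sandpile_class w"
  by (simp add: sandpile_class_def config_of_exponent_add recurrent_rep_add)

lemma sandpile_class_0: "sandpile_class 0 = \<one>\<^bsub>S\<^esub>"
  unfolding sandpile_class_def config_of_exponent_0
  using sandpile_group_one lattice_commute[of "\<one>\<^bsub>S\<^esub>" 0]
  by (intro recurrent_rep_eqI) (simp_all add: config_class_eq_iff lattice_minus)

lemma sandpile_class_single: "sandpile_class (Poly_Mapping.single v 1) = grain_elem G v"
  by (simp only: sandpile_class_def config_of_exponent_single grain_elem_eq)

lemma ex_exponent_class: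
  assumes "a \<in> recurrent_configs G"
  obtains u where "u \<in> exponents G" "sandpile_class u = a"
proof -
  obtain u where "u \<in> exponents G" "config_of_exponent u = a"
    using ex_exponent[OF recurrent_nonneg[OF assms]] .
  then show ?thesis using that assms by (simp add: sandpile_class_def recurrent_rep_self)
qed

definition class_exponent :: "('v \<Rightarrow>\<^sub>0 int) \<Rightarrow> ('v \<Rightarrow>\<^sub>0 nat)" where
  "class_exponent a = (SOME u. u \<in> exponents G \<and> sandpile_class u = a)"

lemma class_exponent:
  assumes "a \<in> recurrent_configs G"
  shows "class_exponent a \<in> exponents G" "sandpile_class (class_exponent a) = a"
  using someI_ex[of "\<lambda>u. u \<in> exponents G \<and> sandpile_class u = a"] ex_exponent_class[OF assms]
  unfolding class_exponent_def by blast+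

definition class_sum :: "('v \<Rightarrow>\<^sub>0 int) \<Rightarrow> 'v cpoly \<Rightarrow> complex" where
  "class_sum a = coeff_sum (\<lambda>m. of_bool (sandpile_class m = a))"

text \<open>A polynomial whose coefficients sum to zero on each class equals the sum of its monomials
  minus chosen monomials of the same classes, hence lies in the span of the binomials.\<close>

lemma toppling_ideal_eq:
  "toppling_ideal G = {p \<in> nonsink_polys G. \<forall>a. class_sum a p = 0}"
proof
  let ?B = "{Poly_Mapping.single u 1 - Poly_Mapping.single w 1 | u w.
        u \<in> exponents G \<and> w \<in> exponents G \<and>
        Poly_Mapping.map int u - Poly_Mapping.map int w \<in> laplacian_lattice G} :: 'v cpoly set"
  let ?K = "{p \<in> nonsink_polys G. \<forall>a. class_sum a p = 0}"
  show "toppling_ideal G \<subseteq> ?K"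
    unfolding toppling_ideal_def
  proof (rule cpoly.span_minimal)
    show "?B \<subseteq> ?K"
    proof safe
      fix u w assume uw: "u \<in> exponents G" "w \<in> exponents G"
        "Poly_Mapping.map int u - Poly_Mapping.map int w \<in> laplacian_lattice G"
      then have "sandpile_class u = sandpile_class w"
        by (simp add: sandpile_class_eq_iff config_of_exponent_def)
      then show "class_sum a (Poly_Mapping.single u 1 - Poly_Mapping.single w 1) = 0" for a
        by (simp add: class_sum_def coeff_sum_diff)
      show "Poly_Mapping.single u 1 - Poly_Mapping.single w 1 \<in> nonsink_polys G"
        using uw by (intro cpoly.subspace_diff[OF subspace_nonsink_polys]) auto
    qed
    show "cpoly.subspace ?K"
    proof (rule cpoly.subspaceI)
      show "0 \<in> ?K" using cpoly.subspace_0[OF subspace_nonsink_polys] by (simp add: class_sum_def)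
      show "p + q \<in> ?K" if "p \<in> ?K" "q \<in> ?K" for p q
        using that cpoly.subspace_add[OF subspace_nonsink_polys, of p G q]
        by (simp add: class_sum_def coeff_sum_add)
      show "poly_scale a p \<in> ?K" if "p \<in> ?K" for a p
        using that cpoly.subspace_scale[OF subspace_nonsink_polys, of p G a]
        by (simp add: class_sum_def coeff_sum_scale)
    qed
  qed
  show "?K \<subseteq> toppling_ideal G"
  proof
    fix p assume "p \<in> ?K"
    then have p: "Poly_Mapping.keys p \<subseteq> exponents G" and 0: "class_sum a p = 0" for a
      by (auto simp: nonsink_polys_def)
    let ?c = "Poly_Mapping.lookup p" and ?k = "Poly_Mapping.keys p"
    let ?x = "\<lambda>u. Poly_Mapping.single u (1::complex)"
    have "(\<Sum>m\<in>?k. poly_scale (?c m) (?x (class_exponent (sandpile_class m))))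
      = (\<Sum>a\<in>sandpile_class ` ?k. \<Sum>m | m \<in> ?k \<and> sandpile_class m = a. poly_scale (?c m) (?x (class_exponent (sandpile_class m))))"
      by (rule sum.image_gen) simp
    also have "\<dots> = (\<Sum>a\<in>sandpile_class ` ?k. poly_scale (class_sum a p) (?x (class_exponent a)))"
    proof (intro sum.cong refl)
      fix a
      have "(\<Sum>m | m \<in> ?k \<and> sandpile_class m = a. poly_scale (?c m) (?x (class_exponent (sandpile_class m))))
        = poly_scale (\<Sum>m | m \<in> ?k \<and> sandpile_class m = a. ?c m) (?x (class_exponent a))"
        by (simp add: cpoly.scale_sum_left)
      also have "(\<Sum>m | m \<in> ?k \<and> sandpile_class m = a. ?c m) = class_sum a p"
        unfolding class_sum_def coeff_sum_def by (intro sum.mono_neutral_cong_left) auto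
      finally show "(\<Sum>m | m \<in> ?k \<and> sandpile_class m = a. poly_scale (?c m) (?x (class_exponent (sandpile_class m))))
        = poly_scale (class_sum a p) (?x (class_exponent a))" .
    qed
    finally have "(\<Sum>m\<in>?k. poly_scale (?c m) (?x (class_exponent (sandpile_class m)))) = 0" by (simp add: 0)
    then have "p = (\<Sum>m\<in>?k. poly_scale (?c m) (?x m - ?x (class_exponent (sandpile_class m))))"
      using cpoly_expand[of p] by (simp add: cpoly.scale_right_diff_distrib sum_subtractf)
    also have "\<dots> \<in> toppling_ideal G"
      unfolding toppling_ideal_def
    proof (intro cpoly.span_sum cpoly.span_scale cpoly.span_base)
      fix m assume "m \<in> ?k"
      then have m: "m \<in> exponents G" using p by blast
      have em: "class_exponent (sandpile_class m) \<in> exponents G" "sandpile_class (class_exponent (sandpile_class m)) = sandpile_class m"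
        using class_exponent[of "sandpile_class m"] m by auto
      then have "Poly_Mapping.map int m - Poly_Mapping.map int (class_exponent (sandpile_class m)) \<in> laplacian_lattice G"
        using m sandpile_class_eq_iff[OF m em(1)] by (simp add: config_of_exponent_def)
      then show "?x m - ?x (class_exponent (sandpile_class m)) \<in> ?B" using m em by blast
    qed
    finally show "p \<in> toppling_ideal G" .
  qed
qed

end

section \<open>Characters as zeros of the toppling ideal\<close>

locale numbered_sandpile = sandpile G for G :: "'v sandpile_graph" +
  fixes n :: nat and \<nu> :: "nat \<Rightarrow> 'v"
  assumes numbering: "bij_betw \<nu> {..<n} (nonsink G)"
begin

lemma \<nu>_V: "i < n \<Longrightarrow> \<nu> i \<in> V"
  using numbering by (auto simp: bij_betw_def)

definition monomial_at :: "complex vec \<Rightarrow> ('v \<Rightarrow>\<^sub>0 nat) \<Rightarrow> complex" where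
  "monomial_at z m = (\<Prod>i<n. (z $ i) ^ Poly_Mapping.lookup m (\<nu> i))"

lemma eval_at_eq: "eval_at n \<nu> z p = coeff_sum (monomial_at z) p"
  by (simp add: eval_at_def coeff_sum_def monomial_at_def)

lemma monomial_at_add: "monomial_at z (u + w) = monomial_at z u * monomial_at z w"
  by (simp add: monomial_at_def lookup_add power_add prod.distrib)

lemma monomial_at_0: "monomial_at z 0 = 1"
  by (simp add: monomial_at_def)

lemma monomial_at_single:
  assumes "i < n"
  shows "monomial_at z (Poly_Mapping.single (\<nu> i) 1) = z $ i"
proof -
  have "monomial_at z (Poly_Mapping.single (\<nu> i) 1) = (\<Prod>j<n. if j = i then z $ i else 1)"
    unfolding monomial_at_def using assms numbering
    by (intro prod.cong) (auto simp: lookup_single when_def bij_betw_def inj_on_def)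
  then show ?thesis using assms by simp
qed

lemma exponent_induct [consumes 1, case_names zero step]:
  assumes "u \<in> exponents G" "P 0"
    and step: "\<And>u i. u \<in> exponents G \<Longrightarrow> i < n \<Longrightarrow> P u \<Longrightarrow> P (u + Poly_Mapping.single (\<nu> i) 1)"
  shows "P u"
  using assms(1)
proof (induction "exponent_deg u" arbitrary: u)
  case 0
  then have "u = 0" by (auto simp: exponent_deg_def in_keys_iff intro!: poly_mapping_eqI)
  then show ?case using assms(2) by simp
next
  case (Suc k)
  have "u \<noteq> 0" using Suc.hyps(2) by (auto simp: exponent_deg_def)
  then obtain v where v: "v \<in> Poly_Mapping.keys u" by (metis keys_eq_empty ex_in_conv)
  then obtain i where i: "i < n" "v = \<nu> i"
    using Suc.prems numbering by (auto simp: exponents_def bij_betw_def)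
  let ?w = "u - Poly_Mapping.single v 1"
  have u: "u = ?w + Poly_Mapping.single v 1"
    using v by (intro poly_mapping_eqI) (auto simp: lookup_add lookup_minus lookup_single when_def in_keys_iff)
  have w: "?w \<in> exponents G"
    using Suc.prems by (auto simp: exponents_def in_keys_iff lookup_minus subset_iff)
  have "config_deg G (config_of_exponent u) = config_deg G (config_of_exponent ?w) + config_deg G (frag_of v)"
    by (subst u) (simp add: config_of_exponent_add config_deg_add config_of_exponent_single[unfolded One_nat_def])
  moreover have "config_deg G (frag_of v) = 1"
    using \<nu>_V[OF i(1)] i(2) by (simp add: config_deg_def)
  ultimately have "k = exponent_deg ?w"
    using Suc.hyps(2) w Suc.prems by (simp add: config_deg_exponent)
  from step[OF w i(1) Suc.hyps(1)[OF this w]] show ?case using u i(2) by simp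
qed

definition character_point :: "(('v \<Rightarrow>\<^sub>0 int) \<Rightarrow> complex) \<Rightarrow> complex vec" where
  "character_point \<chi> = vec n (\<lambda>i. \<chi> (grain_elem G (\<nu> i)))"

lemma sandpile_orbit_eq: "sandpile_orbit G n \<nu> = character_point ` carrier (character_group S)"
  by (simp add: sandpile_orbit_def character_point_def[abs_def])

lemma grain_recurrent: "i < n \<Longrightarrow> grain_elem G (\<nu> i) \<in> recurrent_configs G"
  by (simp add: grain_elem_eq recurrent_rep \<nu>_V)

lemma monomial_at_character_point:
  assumes chi: "\<chi> \<in> hom S complex_units" and u: "u \<in> exponents G"
  shows "monomial_at (character_point \<chi>) u = \<chi> (sandpile_class u)"
  using u
proof (induction rule: exponent_induct)
  case zero
  show ?case using sandpile_group.char_one[OF chi] by (simp add: monomial_at_0 sandpile_class_0)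
next
  case (step u i)
  let ?x = "Poly_Mapping.single (\<nu> i) 1"
  have "sandpile_class (u + ?x) = sandpile_class u \<otimes>\<^bsub>S\<^esub> grain_elem G (\<nu> i)"
    unfolding sandpile_class_single[symmetric] using step \<nu>_V by (intro sandpile_class_add) auto
  then have "\<chi> (sandpile_class (u + ?x)) = \<chi> (sandpile_class u) * \<chi> (grain_elem G (\<nu> i))"
    using sandpile_group.char_mult[OF chi] step grain_recurrent by simp
  moreover have "monomial_at (character_point \<chi>) (u + ?x) = monomial_at (character_point \<chi>) u * \<chi> (grain_elem G (\<nu> i))"
    using step(2) by (simp only: monomial_at_add monomial_at_single) (simp add: character_point_def)
  ultimately show ?case using step by simp
qed

lemma character_in_hom: "\<chi> \<in> carrier (character_group S) \<Longrightarrow> \<chi> \<in> hom S complex_units"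
  by (simp add: character_group_def)

text \<open>Each monomial contributes the value of \<open>\<chi>\<close> at its class; collecting the monomials by class gives the
  class sums.\<close>

lemma eval_at_character_point:
  assumes chi: "\<chi> \<in> hom S complex_units" and p: "p \<in> nonsink_polys G"
  shows "eval_at n \<nu> (character_point \<chi>) p = (\<Sum>a\<in>recurrent_configs G. class_sum a p * \<chi> a)"
proof -
  have p': "Poly_Mapping.keys p \<subseteq> exponents G" using p by (simp add: nonsink_polys_def)
  have "(\<Sum>a\<in>recurrent_configs G. class_sum a p * \<chi> a)
    = (\<Sum>m\<in>Poly_Mapping.keys p. \<Sum>a\<in>recurrent_configs G. Poly_Mapping.lookup p m * (of_bool (sandpile_class m = a) * \<chi> a))"
    by (subst sum.swap) (simp only: class_sum_def coeff_sum_def sum_distrib_right mult.assoc)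
  also have "\<dots> = (\<Sum>m\<in>Poly_Mapping.keys p. Poly_Mapping.lookup p m * \<chi> (sandpile_class m))"
  proof (intro sum.cong refl)
    fix m assume "m \<in> Poly_Mapping.keys p"
    then have "sandpile_class m \<in> recurrent_configs G" using p' by auto
    moreover have "(\<Sum>a\<in>recurrent_configs G. Poly_Mapping.lookup p m * (of_bool (sandpile_class m = a) * \<chi> a))
      = (\<Sum>a\<in>recurrent_configs G. if sandpile_class m = a then Poly_Mapping.lookup p m * \<chi> a else 0)"
      by (intro sum.cong) auto
    ultimately show "(\<Sum>a\<in>recurrent_configs G. Poly_Mapping.lookup p m * (of_bool (sandpile_class m = a) * \<chi> a))
      = Poly_Mapping.lookup p m * \<chi> (sandpile_class m)"
      using finite_recurrent by simp
  qed
  also have "\<dots> = eval_at n \<nu> (character_point \<chi>) p"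
    unfolding eval_at_eq coeff_sum_def using p' by (intro sum.cong) (auto simp: monomial_at_character_point[OF chi])
  finally show ?thesis ..
qed

lemma class_sum_outside:
  assumes "p \<in> nonsink_polys G" "a \<notin> recurrent_configs G"
  shows "class_sum a p = 0"
  unfolding class_sum_def coeff_sum_def
  using assms sandpile_class_recurrent by (intro sum.neutral) (auto simp: nonsink_polys_def)

text \<open>By \<open>eval_at_character_point\<close> the values of \<open>p\<close> on the orbit are the Fourier coefficients of its class
  sums.\<close>

theorem toppling_ideal_eq_vanishing_polys:
  "toppling_ideal G = vanishing_polys G n \<nu> (sandpile_orbit G n \<nu>)"
proof -
  have "(\<forall>a. class_sum a p = 0) \<longleftrightarrow> (\<forall>z\<in>sandpile_orbit G n \<nu>. eval_at n \<nu> z p = 0)"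
    if p: "p \<in> nonsink_polys G" for p
  proof
    assume "\<forall>a. class_sum a p = 0"
    then show "\<forall>z\<in>sandpile_orbit G n \<nu>. eval_at n \<nu> z p = 0"
      using p by (auto simp: sandpile_orbit_eq eval_at_character_point character_in_hom)
  next
    assume 0: "\<forall>z\<in>sandpile_orbit G n \<nu>. eval_at n \<nu> z p = 0"
    have "class_sum a p = 0" if "a \<in> recurrent_configs G" for a
    proof (rule sandpile_group.fourier_injective[where f = "\<lambda>a. class_sum a p"])
      show "(\<Sum>a\<in>carrier S. class_sum a p * \<chi> a) = 0" if "\<chi> \<in> carrier (character_group S)" for \<chi>
        using 0 that eval_at_character_point[OF character_in_hom[OF that] p] by (simp add: sandpile_orbit_eq)
    qed (use that in simp)
    then show "\<forall>a. class_sum a p = 0" using class_sum_outside[OF p] by blast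
  qed
  then show ?thesis unfolding toppling_ideal_eq vanishing_polys_def by blast
qed

text \<open>A zero of the binomials assigns equal values to congruent monomials, so that it defines a
  character.\<close>

theorem zero_locus_toppling_ideal: "zero_locus n \<nu> (toppling_ideal G) = sandpile_orbit G n \<nu>"
proof
  show "sandpile_orbit G n \<nu> \<subseteq> zero_locus n \<nu> (toppling_ideal G)"
    unfolding toppling_ideal_eq_vanishing_polys
    by (auto simp: zero_locus_def vanishing_polys_def sandpile_orbit_def)
next
  show "zero_locus n \<nu> (toppling_ideal G) \<subseteq> sandpile_orbit G n \<nu>"
  proof
    fix z assume z: "z \<in> zero_locus n \<nu> (toppling_ideal G)"
    have eq: "monomial_at z u = monomial_at z w"
      if "u \<in> exponents G" "w \<in> exponents G" "sandpile_class u = sandpile_class w" for u w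
    proof -
      have "Poly_Mapping.single u 1 - Poly_Mapping.single w 1 \<in> toppling_ideal G"
        unfolding toppling_ideal_def using that
        by (intro cpoly.span_base) (auto simp: sandpile_class_eq_iff config_of_exponent_def)
      then have "eval_at n \<nu> z (Poly_Mapping.single u 1 - Poly_Mapping.single w 1) = 0"
        using z by (simp add: zero_locus_def)
      then show ?thesis by (simp add: eval_at_eq coeff_sum_diff)
    qed
    define \<chi> where "\<chi> = restrict (\<lambda>a. monomial_at z (class_exponent a)) (recurrent_configs G)"
    have chi_class: "\<chi> (sandpile_class u) = monomial_at z u" if "u \<in> exponents G" for u
      using that class_exponent[of "sandpile_class u"] by (auto simp: \<chi>_def intro: eq)
    have mult: "\<chi> (a \<otimes>\<^bsub>S\<^esub> b) = \<chi> a * \<chi> b" if "a \<in> recurrent_configs G" "b \<in> recurrent_configs G" for a b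
      using class_exponent[OF that(1)] class_exponent[OF that(2)] chi_class[of "class_exponent a"]
        chi_class[of "class_exponent b"] chi_class[of "class_exponent a + class_exponent b"]
      by (simp add: sandpile_class_add monomial_at_add)
    have one: "\<chi> \<one>\<^bsub>S\<^esub> = 1" using chi_class[of 0] by (simp add: sandpile_class_0 monomial_at_0)
    have "\<chi> a \<noteq> 0" if a: "a \<in> recurrent_configs G" for a
      using mult[OF a, of "inv\<^bsub>S\<^esub> a"] one a sandpile_group.inv_closed[of a] sandpile_group.r_inv[of a] by auto
    then have chi: "\<chi> \<in> carrier (character_group S)"
      using mult by (auto simp: character_group_def hom_complex_units_iff \<chi>_def)
    have "z = character_point \<chi>"
    proof (rule eq_vecI)
      show "dim_vec z = dim_vec (character_point \<chi>)"
        using z by (simp add: zero_locus_def character_point_def)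
      fix i assume "i < dim_vec (character_point \<chi>)"
      then have i: "i < n" by (simp add: character_point_def)
      have "\<chi> (grain_elem G (\<nu> i)) = z $ i"
        using chi_class[of "Poly_Mapping.single (\<nu> i) 1"] \<nu>_V[OF i]
        by (simp only: sandpile_class_single monomial_at_single[OF i] exponents_single)
      then show "z $ i = character_point \<chi> $ i" using i by (simp add: character_point_def)
    qed
    then show "z \<in> sandpile_orbit G n \<nu>" using chi by (simp add: sandpile_orbit_eq)
  qed
qed

section \<open>The representation of the character group\<close>

lemma finite_characters: "finite (carrier (character_group S))"
proof -
  have "carrier (character_group S) \<approx> carrier S"
    using sandpile_group.character_group_iso by (rule iso_imp_eqpoll_carrier)
  then show ?thesis using finite_recurrent eqpoll_finite_iff by auto
qed

lemma finite_orbit: "finite (sandpile_orbit G n \<nu>)"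
  unfolding sandpile_orbit_eq using finite_characters by simp

text \<open>The classes of single grains generate the sandpile group, since every recurrent configuration is
  nonnegative.\<close>

lemma character_eqI:
  assumes "\<chi> \<in> carrier (character_group S)" "\<psi> \<in> carrier (character_group S)"
    and "\<And>i. i < n \<Longrightarrow> \<chi> (grain_elem G (\<nu> i)) = \<psi> (grain_elem G (\<nu> i))"
  shows "\<chi> = \<psi>"
proof (rule extensionalityI)
  show "\<chi> \<in> extensional (carrier S)" "\<psi> \<in> extensional (carrier S)"
    using assms(1,2) by (simp_all add: character_group_def)
  fix a assume "a \<in> carrier S"
  then obtain u where u: "u \<in> exponents G" "sandpile_class u = a" using ex_exponent_class by auto
  have "character_point \<chi> = character_point \<psi>" using assms(3) by (auto simp: character_point_def)
  then show "\<chi> a = \<psi> a"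
    using monomial_at_character_point[OF character_in_hom[OF assms(1)] u(1)]
      monomial_at_character_point[OF character_in_hom[OF assms(2)] u(1)] u(2) by simp
qed

lemma sandpile_rep_inj: "inj_on (sandpile_rep G n \<nu>) (carrier (character_group S))"
proof (rule inj_onI, rule character_eqI)
  fix \<chi> \<psi> i assume "sandpile_rep G n \<nu> \<chi> = sandpile_rep G n \<nu> \<psi>" "i < n"
  then have "sandpile_rep G n \<nu> \<chi> $$ (i, i) = sandpile_rep G n \<nu> \<psi> $$ (i, i)" by simp
  then show "\<chi> (grain_elem G (\<nu> i)) = \<psi> (grain_elem G (\<nu> i))"
    using \<open>i < n\<close> by (simp add: sandpile_rep_def mat_diag_def)
qed

lemma sandpile_rep_hom: "sandpile_rep G n \<nu> \<in> hom (character_group S) (complex_GL n)"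
proof (rule homI)
  fix \<chi> assume chi: "\<chi> \<in> carrier (character_group S)"
  let ?D = "mat_diag n (\<lambda>i. inverse (\<chi> (grain_elem G (\<nu> i))))"
  have nz: "\<chi> (grain_elem G (\<nu> i)) \<noteq> 0" if "i < n" for i
    using sandpile_group.char_nonzero[OF character_in_hom[OF chi]] grain_recurrent[OF that] by simp
  have "sandpile_rep G n \<nu> \<chi> * ?D = 1\<^sub>m n" "?D * sandpile_rep G n \<nu> \<chi> = 1\<^sub>m n"
    unfolding sandpile_rep_def mat_diag_diag using nz by (auto simp: mat_diag_def)
  then have "sandpile_rep G n \<nu> \<chi> \<in> Units (ring_mat TYPE(complex) n ())"
    unfolding Units_def ring_mat_def by (auto simp: sandpile_rep_def mat_diag_def intro!: bexI[of _ ?D])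
  then show "sandpile_rep G n \<nu> \<chi> \<in> carrier (complex_GL n)"
    by (simp add: complex_GL_def units_of_carrier)
next
  fix \<chi> \<psi> assume chi: "\<chi> \<in> carrier (character_group S)" "\<psi> \<in> carrier (character_group S)"
  have "sandpile_rep G n \<nu> (\<chi> \<otimes>\<^bsub>character_group S\<^esub> \<psi>)
    = mat_diag n (\<lambda>i. \<chi> (grain_elem G (\<nu> i)) * \<psi> (grain_elem G (\<nu> i)))"
    using character_group_mult(2)[OF chi sandpile_group.is_group] grain_recurrent
    by (auto simp: sandpile_rep_def mat_diag_def intro!: eq_matI)
  then show "sandpile_rep G n \<nu> (\<chi> \<otimes>\<^bsub>character_group S\<^esub> \<psi>)
    = sandpile_rep G n \<nu> \<chi> \<otimes>\<^bsub>complex_GL n\<^esub> sandpile_rep G n \<nu> \<psi>"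
    by (simp add: complex_GL_def units_of_mult ring_mat_def sandpile_rep_def)
qed

lemma sandpile_rep_point:
  assumes "\<chi> \<in> carrier (character_group S)" "\<psi> \<in> carrier (character_group S)"
  shows "sandpile_rep G n \<nu> \<chi> *\<^sub>v character_point \<psi> = character_point (\<chi> \<otimes>\<^bsub>character_group S\<^esub> \<psi>)"
  using character_group_mult(2)[OF assms sandpile_group.is_group] grain_recurrent
  by (auto simp: sandpile_rep_def mat_diag_def character_point_def scalar_prod_def
      if_distrib[of "\<lambda>x. x * _"] intro!: eq_vecI cong: if_cong)

theorem sandpile_rep_orbit:
  assumes chi: "\<chi> \<in> carrier (character_group S)"
  shows "(\<lambda>z. sandpile_rep G n \<nu> \<chi> *\<^sub>v z) ` sandpile_orbit G n \<nu> = sandpile_orbit G n \<nu>"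
proof -
  let ?C = "character_group S"
  define \<chi>' where "\<chi>' = restrict (\<lambda>a. inverse (\<chi> a)) (carrier S)"
  have chi': "\<chi>' \<in> carrier ?C"
    using chi by (auto simp: \<chi>'_def character_group_def hom_complex_units_iff config_class_mult)
  have "(\<lambda>\<psi>. \<chi> \<otimes>\<^bsub>?C\<^esub> \<psi>) ` carrier ?C = carrier ?C"
  proof
    show "(\<lambda>\<psi>. \<chi> \<otimes>\<^bsub>?C\<^esub> \<psi>) ` carrier ?C \<subseteq> carrier ?C"
      using character_group_mult(1)[OF chi _ sandpile_group.is_group] by auto
    show "carrier ?C \<subseteq> (\<lambda>\<psi>. \<chi> \<otimes>\<^bsub>?C\<^esub> \<psi>) ` carrier ?C"
    proof
      fix \<psi> assume psi: "\<psi> \<in> carrier ?C"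
      note in1 = character_group_mult[OF chi' psi sandpile_group.is_group]
      note in2 = character_group_mult[OF chi in1(1) sandpile_group.is_group]
      have "\<psi> = \<chi> \<otimes>\<^bsub>?C\<^esub> (\<chi>' \<otimes>\<^bsub>?C\<^esub> \<psi>)"
      proof (rule character_eqI[OF psi in2(1)])
        fix i assume "i < n"
        then have g: "grain_elem G (\<nu> i) \<in> carrier S" using grain_recurrent by simp
        then show "\<psi> (grain_elem G (\<nu> i)) = (\<chi> \<otimes>\<^bsub>?C\<^esub> (\<chi>' \<otimes>\<^bsub>?C\<^esub> \<psi>)) (grain_elem G (\<nu> i))"
          using sandpile_group.char_nonzero[OF character_in_hom[OF chi] g]
          by (simp only: in2(2) in1(2)) (simp add: \<chi>'_def)
      qed
      then show "\<psi> \<in> (\<lambda>\<psi>. \<chi> \<otimes>\<^bsub>?C\<^esub> \<psi>) ` carrier ?C" using in1(1) by blast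
    qed
  qed
  then have "character_point ` (\<lambda>\<psi>. \<chi> \<otimes>\<^bsub>?C\<^esub> \<psi>) ` carrier ?C = sandpile_orbit G n \<nu>"
    by (simp only: sandpile_orbit_eq)
  moreover have "(\<lambda>z. sandpile_rep G n \<nu> \<chi> *\<^sub>v z) ` sandpile_orbit G n \<nu>
    = character_point ` (\<lambda>\<psi>. \<chi> \<otimes>\<^bsub>?C\<^esub> \<psi>) ` carrier ?C"
    unfolding sandpile_orbit_eq image_image using sandpile_rep_point[OF chi] by (intro image_cong) auto
  ultimately show ?thesis by simp
qed

end

section \<open>The affine Hilbert function\<close>

text \<open>The coset of \<open>p\<close> in any space of polynomials that contains \<open>p\<close> and \<open>W\<close>, expressed without that space so
  that cosets can be added and scaled through their representatives.\<close>

definition poly_coset :: "'v cpoly set \<Rightarrow> 'v cpoly \<Rightarrow> 'v cpoly set" where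
  "poly_coset W p = {q. q - p \<in> W}"

context
  fixes G :: "'v sandpile_graph" and d :: nat and W :: "'v cpoly set"
  assumes W: "cpoly.subspace W" "W \<subseteq> polys_le G d"
begin

abbreviation "truncated_space \<equiv> polys_le_space G d"
abbreviation "truncated_quotient \<equiv> quotient_space truncated_space W"

lemma poly_coset_eq_iff: "poly_coset W p = poly_coset W q \<longleftrightarrow> p - q \<in> W"
proof
  assume eq: "poly_coset W p = poly_coset W q"
  have "p \<in> poly_coset W p" using cpoly.subspace_0[OF W(1)] by (simp add: poly_coset_def)
  then show "p - q \<in> W" unfolding eq by (simp add: poly_coset_def)
next
  assume pq: "p - q \<in> W"
  have "r - p \<in> W \<longleftrightarrow> r - q \<in> W" for r
    using cpoly.subspace_add[OF W(1) _ pq, of "r - p"] cpoly.subspace_diff[OF W(1) _ pq, of "r - q"] by auto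
  then show "poly_coset W p = poly_coset W q" by (simp add: poly_coset_def)
qed

lemma quotient_zero: "\<zero>\<^bsub>truncated_quotient\<^esub> = poly_coset W 0"
  by (simp add: quotient_space_def poly_coset_def)

lemma carrier_quotient: "carrier truncated_quotient = poly_coset W ` polys_le G d"
proof -
  have "a_r_coset truncated_space W p = poly_coset W p" for p
  proof -
    have "a_r_coset truncated_space W p = {w + p |w. w \<in> W}"
      by (auto simp: a_r_coset_def r_coset_def polys_le_space_def)
    also have "\<dots> = poly_coset W p" unfolding poly_coset_def by (auto intro: exI[of _ "_ - p"])
    finally show ?thesis .
  qed
  then show ?thesis by (auto simp: quotient_space_def A_RCOSETS_def RCOSETS_def a_r_coset_def polys_le_space_def)
qed

lemma set_add_poly_coset: "poly_coset W p <+>\<^bsub>truncated_space\<^esub> poly_coset W q = poly_coset W (p + q)"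
proof
  have "(a + b) - (p + q) \<in> W" if "a - p \<in> W" "b - q \<in> W" for a b
    using cpoly.subspace_add[OF W(1) that] by (simp add: algebra_simps)
  then show "poly_coset W p <+>\<^bsub>truncated_space\<^esub> poly_coset W q \<subseteq> poly_coset W (p + q)"
    by (auto simp: set_add_def set_mult_def polys_le_space_def poly_coset_def)
  show "poly_coset W (p + q) \<subseteq> poly_coset W p <+>\<^bsub>truncated_space\<^esub> poly_coset W q"
  proof
    fix r assume "r \<in> poly_coset W (p + q)"
    then have "r - q \<in> poly_coset W p" "q \<in> poly_coset W q" "r = (r - q) + q"
      using cpoly.subspace_0[OF W(1)] by (auto simp: poly_coset_def algebra_simps)
    then show "r \<in> poly_coset W p <+>\<^bsub>truncated_space\<^esub> poly_coset W q"
      unfolding set_add_def set_mult_def polys_le_space_def by force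
  qed
qed

lemma quotient_add: "poly_coset W p \<oplus>\<^bsub>truncated_quotient\<^esub> poly_coset W q = poly_coset W (p + q)"
  using set_add_poly_coset by (simp add: quotient_space_def)

lemma quotient_smult: "a \<odot>\<^bsub>truncated_quotient\<^esub> poly_coset W p = poly_coset W (poly_scale a p)"
proof -
  have "W <+>\<^bsub>truncated_space\<^esub> poly_scale a ` poly_coset W p = poly_coset W (poly_scale a p)"
  proof
    have "w + poly_scale a q - poly_scale a p \<in> W" if "w \<in> W" "q - p \<in> W" for w q
      using cpoly.subspace_add[OF W(1) that(1) cpoly.subspace_scale[OF W(1) that(2), of a]]
      by (simp add: cpoly.scale_right_diff_distrib algebra_simps)
    then show "W <+>\<^bsub>truncated_space\<^esub> poly_scale a ` poly_coset W p \<subseteq> poly_coset W (poly_scale a p)"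
      by (auto simp: set_add_def set_mult_def polys_le_space_def poly_coset_def)
    show "poly_coset W (poly_scale a p) \<subseteq> W <+>\<^bsub>truncated_space\<^esub> poly_scale a ` poly_coset W p"
    proof
      fix r assume "r \<in> poly_coset W (poly_scale a p)"
      then have "r - poly_scale a p \<in> W" "p \<in> poly_coset W p" "r = (r - poly_scale a p) + poly_scale a p"
        using cpoly.subspace_0[OF W(1)] by (auto simp: poly_coset_def)
      then show "r \<in> W <+>\<^bsub>truncated_space\<^esub> poly_scale a ` poly_coset W p"
        unfolding set_add_def set_mult_def polys_le_space_def by force
    qed
  qed
  then show ?thesis by (simp add: quotient_space_def polys_le_space_def)
qed

lemma vectorspace_quotient: "vectorspace class_ring truncated_quotient"
proof (rule vs_criteria)
  show "field (class_ring :: complex ring)" by (rule class_field)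
  note U = subspace_polys_le[of G d]
  show "\<forall>v\<in>carrier truncated_quotient. \<exists>neg_v\<in>carrier truncated_quotient. v \<oplus>\<^bsub>truncated_quotient\<^esub> neg_v = \<zero>\<^bsub>truncated_quotient\<^esub>"
  proof
    fix v assume "v \<in> carrier truncated_quotient"
    then obtain p where p: "p \<in> polys_le G d" "v = poly_coset W p" by (auto simp: carrier_quotient)
    then have "v \<oplus>\<^bsub>truncated_quotient\<^esub> poly_coset W (- p) = \<zero>\<^bsub>truncated_quotient\<^esub>" "poly_coset W (- p) \<in> carrier truncated_quotient"
      using cpoly.subspace_neg[OF U] by (auto simp: quotient_add quotient_zero carrier_quotient)
    then show "\<exists>neg_v\<in>carrier truncated_quotient. v \<oplus>\<^bsub>truncated_quotient\<^esub> neg_v = \<zero>\<^bsub>truncated_quotient\<^esub>" by blast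
  qed
qed (auto simp: carrier_quotient quotient_add quotient_zero quotient_smult
      cpoly.scale_left_distrib cpoly.scale_right_distrib add_ac
      intro!: imageI cpoly.subspace_0[OF subspace_polys_le] cpoly.subspace_add[OF subspace_polys_le]
        cpoly.subspace_scale[OF subspace_polys_le])

text \<open>The cosets of a dual system \<open>b\<close> of the functionals \<open>\<phi>\<close> are a basis of the quotient by their common
  kernel: the combination of \<open>b\<close> with coefficients \<open>\<phi> i p\<close> is congruent to \<open>p\<close>, and it is the only
  combination that is.\<close>

lemma dim_quotient_dual_system:
  fixes \<phi> :: "nat \<Rightarrow> 'v cpoly \<Rightarrow> complex"
  assumes add: "\<And>i p q. \<phi> i (p + q) = \<phi> i p + \<phi> i q"
    and scale: "\<And>i a p. \<phi> i (poly_scale a p) = a * \<phi> i p"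
    and ker: "\<And>p. p \<in> polys_le G d \<Longrightarrow> p \<in> W \<longleftrightarrow> (\<forall>i<k. \<phi> i p = 0)"
    and b: "\<And>i. i < k \<Longrightarrow> b i \<in> polys_le G d"
    and dual: "\<And>i j. i < k \<Longrightarrow> j < k \<Longrightarrow> \<phi> i (b j) = of_bool (i = j)"
  shows "vectorspace.dim class_ring truncated_quotient = k"
proof -
  note U = subspace_polys_le[of G d]
  define comb where "comb v = (\<Sum>j<k. poly_scale (v $ j) (b j))" for v :: "complex vec"
  have comb_U: "comb v \<in> polys_le G d" for v
    unfolding comb_def using b by (intro cpoly.subspace_sum[OF U] cpoly.subspace_scale[OF U]) auto
  have zero: "\<phi> i 0 = 0" for i using scale[of i 0 0] by simp
  have \<phi>_sum: "\<phi> i (sum f I) = (\<Sum>j\<in>I. \<phi> i (f j))" for i f and I :: "nat set"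
    by (induction I rule: infinite_finite_induct) (simp_all add: add zero)
  have \<phi>_comb: "\<phi> i (comb v) = v $ i" if "i < k" for i v
  proof -
    have "\<phi> i (comb v) = (\<Sum>j<k. if j = i then v $ i else 0)"
      unfolding comb_def \<phi>_sum using that by (intro sum.cong) (auto simp: scale dual)
    then show ?thesis using that by simp
  qed
  have \<phi>_diff: "\<phi> i (p - q) = \<phi> i p - \<phi> i q" for i p q
    using add[of i "p - q" q] by simp
  define T where "T v = poly_coset W (comb v)" for v
  interpret vec_space "TYPE(complex)" k .
  let ?Vk = "module_vec TYPE(complex) k"
  interpret T: linear_map class_ring ?Vk truncated_quotient T
  proof (intro linear_map.intro mod_hom.intro mod_hom_axioms.intro)
    show "vectorspace class_ring ?Vk" by (rule vec_vs)
    show "vectorspace class_ring truncated_quotient" by (rule vectorspace_quotient)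
    show "Module.module class_ring ?Vk" by (rule vec_module)
    show "Module.module class_ring truncated_quotient" using vectorspace_quotient by (simp add: vectorspace_def)
    have "comb (v + w) = comb v + comb w" if "v \<in> carrier_vec k" "w \<in> carrier_vec k" for v w
      using that by (simp add: comb_def cpoly.scale_left_distrib sum.distrib)
    moreover have "comb (a \<cdot>\<^sub>v v) = poly_scale a (comb v)" if "v \<in> carrier_vec k" for a v
      using that by (simp add: comb_def cpoly.scale_sum_right)
    ultimately show "T \<in> module_hom class_ring ?Vk truncated_quotient"
      by (auto simp: module_hom_def module_vec_simps T_def carrier_quotient comb_U quotient_add quotient_smult)
  qed
  have "inj_on T (carrier_vec k)"
  proof (rule inj_onI)
    fix v w assume v: "v \<in> carrier_vec k" and w: "w \<in> carrier_vec k" and "T v = T w"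
    then have "comb v - comb w \<in> W" by (simp add: T_def poly_coset_eq_iff)
    moreover have "comb v - comb w \<in> polys_le G d" by (intro cpoly.subspace_diff[OF U] comb_U)
    ultimately have "\<forall>i<k. \<phi> i (comb v - comb w) = 0" using ker by blast
    then show "v = w" using v w by (intro eq_vecI) (auto simp: \<phi>_diff \<phi>_comb)
  qed
  moreover have "T ` carrier_vec k = carrier truncated_quotient"
  proof
    show "T ` carrier_vec k \<subseteq> carrier truncated_quotient" by (auto simp: T_def carrier_quotient comb_U)
    show "carrier truncated_quotient \<subseteq> T ` carrier_vec k"
    proof
      fix x assume "x \<in> carrier truncated_quotient"
      then obtain p where p: "p \<in> polys_le G d" "x = poly_coset W p" by (auto simp: carrier_quotient)
      let ?v = "vec k (\<lambda>i. \<phi> i p)"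
      have "p - comb ?v \<in> polys_le G d" by (intro cpoly.subspace_diff[OF U] p(1) comb_U)
      then have "p - comb ?v \<in> W" using ker by (simp add: \<phi>_diff \<phi>_comb)
      then have "x = T ?v" by (simp add: T_def p(2) poly_coset_eq_iff)
      then show "x \<in> T ` carrier_vec k" by auto
    qed
  qed
  ultimately have "dim = vectorspace.dim class_ring truncated_quotient"
    using fin_dim by (intro T.dim_eq) (simp_all add: module_vec_simps)
  then show ?thesis using dim_is_n by simp
qed

end

context sandpile
begin

text \<open>Effective as for divisors: represented by a nonnegative configuration, here of bounded degree.\<close>

definition effective_classes :: "nat \<Rightarrow> ('v \<Rightarrow>\<^sub>0 int) set" where
  "effective_classes d = sandpile_class ` {u \<in> exponents G. exponent_deg u \<le> d}"

lemma effective_classes_recurrent: "effective_classes d \<subseteq> recurrent_configs G"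
  by (auto simp: effective_classes_def)

text \<open>On polynomials of degree at most \<open>d\<close> the class sums outside the effective classes are zero, so those
  of the effective classes cut out the toppling ideal. Monomials of degree at most \<open>d\<close>, one in each
  effective class, form a dual system.\<close>

lemma affine_hilbert_eq_card_effective: "affine_hilbert G d = card (effective_classes d)"
proof -
  define W where "W = toppling_ideal G \<inter> polys_le G d"
  define k where "k = card (effective_classes d)"
  have "finite (effective_classes d)"
    using effective_classes_recurrent finite_recurrent by (rule finite_subset)
  then obtain a where a: "bij_betw a {..<k} (effective_classes d)"
    unfolding k_def by (metis atLeast0LessThan ex_bij_betw_nat_finite)
  have aE: "a i \<in> effective_classes d" if "i < k" for i using a that by (auto simp: bij_betw_def)
  define e where "e i = (SOME u. u \<in> exponents G \<and> exponent_deg u \<le> d \<and> sandpile_class u = a i)" for i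
  have e: "e i \<in> exponents G" "exponent_deg (e i) \<le> d" "sandpile_class (e i) = a i" if "i < k" for i
  proof -
    have "\<exists>u. u \<in> exponents G \<and> exponent_deg u \<le> d \<and> sandpile_class u = a i"
      using aE[OF that] unfolding effective_classes_def by force
    from someI_ex[OF this] show "e i \<in> exponents G" "exponent_deg (e i) \<le> d" "sandpile_class (e i) = a i"
      unfolding e_def by auto
  qed
  have "vectorspace.dim class_ring (quotient_space (polys_le_space G d) W) = k"
  proof (rule dim_quotient_dual_system[where \<phi> = "\<lambda>i. class_sum (a i)" and b = "\<lambda>i. Poly_Mapping.single (e i) 1"])
    show "cpoly.subspace W"
      unfolding W_def toppling_ideal_def by (intro cpoly.subspace_inter cpoly.subspace_span subspace_polys_le)
    show "W \<subseteq> polys_le G d" by (simp add: W_def)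
    show "class_sum (a i) (p + q) = class_sum (a i) p + class_sum (a i) q" for i p q
      by (simp add: class_sum_def coeff_sum_add)
    show "class_sum (a i) (poly_scale c p) = c * class_sum (a i) p" for i c p
      by (simp add: class_sum_def coeff_sum_scale)
    show "Poly_Mapping.single (e i) 1 \<in> polys_le G d" if "i < k" for i
      using e[OF that] by (simp add: polys_le_def)
    show "class_sum (a i) (Poly_Mapping.single (e j) 1) = of_bool (i = j)" if "i < k" "j < k" for i j
      using e[OF that(2)] a that by (auto simp: class_sum_def bij_betw_def inj_on_def)
    fix p assume p: "p \<in> polys_le G d"
    have "class_sum c p = 0" if "c \<notin> effective_classes d" for c
      unfolding class_sum_def coeff_sum_def using that p
      by (intro sum.neutral) (auto simp: polys_le_def nonsink_polys_def effective_classes_def)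
    moreover have "(\<forall>i<k. class_sum (a i) p = 0) \<longleftrightarrow> (\<forall>c\<in>a ` {..<k}. class_sum c p = 0)"
      by auto
    moreover have "a ` {..<k} = effective_classes d" using a by (simp add: bij_betw_def)
    ultimately have "(\<forall>i<k. class_sum (a i) p = 0) \<longleftrightarrow> (\<forall>c. class_sum c p = 0)" by blast
    then show "p \<in> W \<longleftrightarrow> (\<forall>i<k. class_sum (a i) p = 0)"
      using p by (simp add: W_def toppling_ideal_eq polys_le_def)
  qed
  then show ?thesis by (simp add: affine_hilbert_def W_def k_def)
qed

lemma config_class_effective:
  "config_class G ` effective_classes d =
     {A \<in> carrier (config_class_group G). \<exists>c\<in>A. nonneg_config G c \<and> config_deg G c \<le> int d}"
proof (intro equalityI subsetI)
  fix A assume "A \<in> config_class G ` effective_classes d"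
  then obtain u where u: "u \<in> exponents G" "exponent_deg u \<le> d" "A = config_class G (sandpile_class u)"
    by (auto simp: effective_classes_def)
  then have A: "A = config_class G (config_of_exponent u)" by (simp add: sandpile_class_def recurrent_rep)
  then have "config_of_exponent u \<in> A" by (simp add: mem_config_class_iff)
  then show "A \<in> {A \<in> carrier (config_class_group G). \<exists>c\<in>A. nonneg_config G c \<and> config_deg G c \<le> int d}"
    using u(1,2) A by (auto simp: carrier_class_group config_of_exponent_nonneg config_deg_exponent
        intro!: bexI[of _ "config_of_exponent u"])
next
  fix A assume "A \<in> {A \<in> carrier (config_class_group G). \<exists>c\<in>A. nonneg_config G c \<and> config_deg G c \<le> int d}"
  then obtain c b where c: "c \<in> A" "nonneg_config G c" "config_deg G c \<le> int d"
    and b: "b \<in> configs" "A = config_class G b" by (auto simp: carrier_class_group)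
  obtain u where u: "u \<in> exponents G" "config_of_exponent u = c" using ex_exponent[OF c(2)] .
  have "c - b \<in> L" using c(1) b(2) mem_config_class_iff by simp
  then have "A = config_class G c" unfolding b(2) config_class_eq_iff by (rule lattice_commute)
  moreover have "config_class G (sandpile_class u) = config_class G c"
    using u by (auto simp: sandpile_class_def recurrent_rep)
  moreover have "sandpile_class u \<in> effective_classes d"
    using u c(3) config_deg_exponent[OF u(1)] by (auto simp: effective_classes_def)
  ultimately show "A \<in> config_class G ` effective_classes d" by blast
qed

theorem affine_hilbert_eq_card_classes:
  "affine_hilbert G d = card {A \<in> carrier (config_class_group G).
     \<exists>c\<in>A. nonneg_config G c \<and> config_deg G c \<le> int d}"
proof -
  have "inj_on (config_class G) (effective_classes d)"
    using bij_recurrent effective_classes_recurrent by (auto simp: bij_betw_def intro: inj_on_subset)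
  then show ?thesis
    unfolding affine_hilbert_eq_card_effective config_class_effective[symmetric] by (simp add: card_image)
qed

text \<open>The superstable configuration in the class of a nonnegative \<open>c\<close> has at most as many grains as \<open>c\<close>.\<close>

theorem affine_hilbert_eq_card_superstable:
  "affine_hilbert G d = card {c \<in> superstable_configs G. config_deg G c \<le> int d}"
proof -
  have "config_class G ` {c \<in> superstable_configs G. config_deg G c \<le> int d}
    = {A \<in> carrier (config_class_group G). \<exists>c\<in>A. nonneg_config G c \<and> config_deg G c \<le> int d}"
  proof (intro equalityI subsetI)
    fix A assume "A \<in> config_class G ` {c \<in> superstable_configs G. config_deg G c \<le> int d}"
    then obtain c where "c \<in> superstable_configs G" "config_deg G c \<le> int d" "A = config_class G c" by blast
    then show "A \<in> {A \<in> carrier (config_class_group G). \<exists>c\<in>A. nonneg_config G c \<and> config_deg G c \<le> int d}"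
      using superstable_config by (auto simp: carrier_class_group superstable_iff mem_config_class_iff intro!: bexI[of _ c])
  next
    fix A assume "A \<in> {A \<in> carrier (config_class_group G). \<exists>c\<in>A. nonneg_config G c \<and> config_deg G c \<le> int d}"
    then obtain c b where c: "c - b \<in> L" "nonneg_config G c" "config_deg G c \<le> int d"
      and b: "A = config_class G b" by (auto simp: carrier_class_group mem_config_class_iff)
    obtain s where s: "s \<in> superstable_configs G" "c - s \<in> L" "config_deg G s \<le> config_deg G c"
      using ex_superstable_below[OF c(2)] .
    have "A = config_class G s"
      unfolding b config_class_eq_iff using lattice_commute[OF c(1)] s(2) by (rule lattice_trans)
    then show "A \<in> config_class G ` {c \<in> superstable_configs G. config_deg G c \<le> int d}"
      using s c(3) by auto
  qed
  moreover have "card (config_class G ` {c \<in> superstable_configs G. config_deg G c \<le> int d})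
    = card {c \<in> superstable_configs G. config_deg G c \<le> int d}"
    using bij_superstable by (intro card_image) (auto simp: bij_betw_def inj_on_def)
  ultimately show ?thesis unfolding affine_hilbert_eq_card_classes by simp
qed

theorem affine_hilbert_eq_card_recurrent:
  "affine_hilbert G d = card {c \<in> recurrent_configs G. config_deg G c \<ge> config_deg G c_max - int d}"
proof -
  have "bij_betw (\<lambda>c. c_max - c) {c \<in> superstable_configs G. config_deg G c \<le> int d}
    {c \<in> recurrent_configs G. config_deg G c \<ge> config_deg G c_max - int d}"
    by (rule bij_betwI[where g = "\<lambda>c. c_max - c"])
      (auto simp: recurrent_iff_superstable superstable_config config_deg_diff
        recurrent_iff_superstable[OF recurrent_config, THEN iffD1])
  then show ?thesis unfolding affine_hilbert_eq_card_superstable by (rule bij_betw_same_card)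
qed

end

theorem corollary6p6:
  fixes G :: "'v sandpile_graph" and n :: nat and \<nu> :: "nat \<Rightarrow> 'v"
  assumes "is_sandpile_graph G"
    and "bij_betw \<nu> {..<n} (nonsink G)"
  shows
    "(sandpile_rep G n \<nu> \<in> hom (character_group (sandpile_group G)) (complex_GL n)
     \<and> inj_on (sandpile_rep G n \<nu>) (carrier (character_group (sandpile_group G)))
     \<and> toppling_ideal G = vanishing_polys G n \<nu> (sandpile_orbit G n \<nu>))
     \<and>
     (zero_locus n \<nu> (toppling_ideal G) = sandpile_orbit G n \<nu>
     \<and> finite (sandpile_orbit G n \<nu>)
     \<and> (\<forall>\<chi>\<in>carrier (character_group (sandpile_group G)).
          (\<lambda>z. sandpile_rep G n \<nu> \<chi> *\<^sub>v z) ` zero_locus n \<nu> (toppling_ideal G)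
            = zero_locus n \<nu> (toppling_ideal G))
     \<and> character_group (sandpile_group G) \<cong> sandpile_group G)
     \<and>
     (\<forall>d. affine_hilbert G d
           = card {A \<in> carrier (config_class_group G).
               \<exists>c\<in>A. nonneg_config G c \<and> config_deg G c \<le> int d}
         \<and> affine_hilbert G d
           = card {c \<in> superstable_configs G. config_deg G c \<le> int d}
         \<and> affine_hilbert G d
           = card {c \<in> recurrent_configs G.
               config_deg G c \<ge> config_deg G (max_stable_config G) - int d})"
proof -
  interpret numbered_sandpile G n \<nu>
    using assms by unfold_locales
  show ?thesis
    unfolding zero_locus_toppling_ideal
    by (intro conjI allI ballI refl sandpile_rep_hom sandpile_rep_inj toppling_ideal_eq_vanishing_polys
        finite_orbit sandpile_rep_orbit sandpile_group.character_group_iso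
        affine_hilbert_eq_card_classes affine_hilbert_eq_card_superstable affine_hilbert_eq_card_recurrent)
qed

end
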